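(* Let $k$ be an algebraically closed field of characteristic $p\ge 3$ and let $(\mathfrak g,[p])$ be a finite-dimensional restricted Lie algebra over $k$ such that $\mathrm{rk}_p(\mathfrak g)=1$. If $r(\mathfrak g)\ge 2$, then $\mathfrak g$ is generically toral.
   Context: A torus of $\mathfrak g$ is an abelian $p$-subalgebra on which the $p$-map is bijective. $\mathfrak g$ is generically toral if it contains a self-centralizing torus, i.e. a torus $\mathfrak t$ with $C_{\mathfrak g}(\mathfrak t)=\mathfrak t$. $\mathrm{Tor}(\mathfrak g)$ is the set of tori of maximal dimension. For $\mathfrak t\in\mathrm{Tor}(\mathfrak g)$ there is the root space decomposition $\mathfrak g=C_{\mathfrak g}(\mathfrak t)\oplus\bigoplus_{\alpha\in R_{\mathfrak t}}\mathfrak g_\alpha$ with $R_{\mathfrak t}\subseteq\mathfrak t^*\smallsetminus\{0\}$ the set of roots; the number $r(\mathfrak g):=|R_{\mathfrak t}|$ is independent of the choice of $\mathfrak t\in\mathrm{Tor}(\mathfrak g)$. $\mathbb E(r,\mathfrak g)$ is the set of $r$-dimensional subspaces $\mathfrak e\subseteq\mathfrak g$ with $[\mathfrak e,\mathfrak e]=(0)$ and $x^{[p]}=0$ for all $x\in\mathfrak e$; $\mathrm{rk}_p(\mathfrak g)=\max\{r\in\mathbb N_0:\mathbb E(r,\mathfrak g)\neq\emptyset\}$. *)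

theory Defs
  imports "HOL-Computational_Algebra.Polynomial" "HOL-Library.FuncSet"
begin

text \<open>
  The Lie algebra is the whole type \<open>'g\<close>; subalgebras, tori and so on are subsets of it.
\<close>

locale lie_algebra = vector_space scale
  for scale :: "'k::field \<Rightarrow> 'g::ab_group_add \<Rightarrow> 'g" +
  fixes bracket :: "'g \<Rightarrow> 'g \<Rightarrow> 'g"
  assumes linear_bracket_right: "Vector_Spaces.linear scale scale (\<lambda>y. bracket x y)"
    and linear_bracket_left: "Vector_Spaces.linear scale scale (\<lambda>x. bracket x y)"
    and bracket_self: "bracket x x = 0"
    and jacobi: "bracket x (bracket y z) + bracket y (bracket z x) + bracket z (bracket x y) = 0"
begin

text \<open>
  An element of \<open>'g poly\<close> stands for an element of \<open>\<gg> \<otimes> k[T]\<close>, the tensor product of the Lie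
  algebra with the polynomial ring in \<open>T\<close>. On it, \<open>ad_pencil x y\<close> is the operator
  \<open>ad (x \<otimes> T + y \<otimes> 1)\<close>.
\<close>

definition ad_pencil :: "'g \<Rightarrow> 'g \<Rightarrow> 'g poly \<Rightarrow> 'g poly" where
  "ad_pencil x y f = pCons 0 (map_poly (bracket x) f) + map_poly (bracket y) f"

text \<open>
  Jacobson's terms \<open>s\<^sub>i(x, y)\<close> for \<open>1 \<le> i \<le> p - 1\<close>, determined by
  \<open>(ad (x \<otimes> T + y \<otimes> 1))\<^bsup>p-1\<^esup> (x \<otimes> 1) = \<Sum>\<^sub>i i s\<^sub>i(x, y) \<otimes> T\<^bsup>i-1\<^esup>\<close>
  where \<open>p\<close> is the characteristic of the field.
\<close>

definition jacobson_term :: "nat \<Rightarrow> 'g \<Rightarrow> 'g \<Rightarrow> 'g" where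
  "jacobson_term i x y =
     scale (inverse (of_nat i)) (coeff ((ad_pencil x y ^^ (CHAR('k) - 1)) [:x:]) (i - 1))"

definition centralizer :: "'g set \<Rightarrow> 'g set" where
  "centralizer S = {x. \<forall>h\<in>S. bracket h x = 0}"

text \<open>
  Linear functionals on a subspace \<open>V\<close> are represented by functions that are \<open>undefined\<close> outside
  \<open>V\<close>, so that functionals agreeing on \<open>V\<close> are equal and can be counted.
\<close>

definition dual_space :: "'g set \<Rightarrow> ('g \<Rightarrow> 'k) set" where
  "dual_space V = {\<alpha> \<in> extensional V.
     (\<forall>x\<in>V. \<forall>y\<in>V. \<alpha> (x + y) = \<alpha> x + \<alpha> y) \<and> (\<forall>c. \<forall>x\<in>V. \<alpha> (scale c x) = c * \<alpha> x)}"

definition root_space :: "'g set \<Rightarrow> ('g \<Rightarrow> 'k) \<Rightarrow> 'g set" where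
  "root_space V \<alpha> = {x. \<forall>h\<in>V. bracket h x = scale (\<alpha> h) x}"

definition roots :: "'g set \<Rightarrow> ('g \<Rightarrow> 'k) set" where
  "roots V = {\<alpha> \<in> dual_space V. \<alpha> \<noteq> (\<lambda>h\<in>V. 0) \<and> root_space V \<alpha> \<noteq> {0}}"

end

locale restricted_lie_algebra = lie_algebra scale bracket
  for scale :: "'k::field \<Rightarrow> 'g::ab_group_add \<Rightarrow> 'g" and bracket :: "'g \<Rightarrow> 'g \<Rightarrow> 'g" +
  fixes pmap :: "'g \<Rightarrow> 'g"
  assumes char_pos: "CHAR('k) > 0"
    and bracket_pmap: "bracket (pmap x) = bracket x ^^ CHAR('k)"
    and pmap_scale: "pmap (scale c x) = scale (c ^ CHAR('k)) (pmap x)"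
    and pmap_add: "pmap (x + y) = pmap x + pmap y + (\<Sum>i = 1..CHAR('k) - 1. jacobson_term i x y)"
begin

definition p_subalgebra :: "'g set \<Rightarrow> bool" where
  "p_subalgebra V \<longleftrightarrow>
     subspace V \<and> (\<forall>x\<in>V. \<forall>y\<in>V. bracket x y \<in> V) \<and> (\<forall>x\<in>V. pmap x \<in> V)"

definition torus :: "'g set \<Rightarrow> bool" where
  "torus V \<longleftrightarrow> p_subalgebra V \<and> (\<forall>x\<in>V. \<forall>y\<in>V. bracket x y = 0) \<and> bij_betw pmap V V"

definition generically_toral :: bool where
  "generically_toral \<longleftrightarrow> (\<exists>V. torus V \<and> centralizer V = V)"

definition Tor :: "'g set set" where
  "Tor = {V. torus V \<and> (\<forall>W. torus W \<longrightarrow> dim W \<le> dim V)}"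

text \<open>
  The number of roots is known not to depend on the torus of maximal dimension; the definition
  evaluates it at a chosen one.
\<close>

definition num_roots :: nat where
  "num_roots = card (roots (SOME V. V \<in> Tor))"

definition elementary_subalgebras :: "nat \<Rightarrow> 'g set set" where
  "elementary_subalgebras r = {V. subspace V \<and> dim V = r \<and>
     (\<forall>x\<in>V. \<forall>y\<in>V. bracket x y = 0) \<and> (\<forall>x\<in>V. pmap x = 0)}"

definition p_rank :: nat where
  "p_rank = Max {r. elementary_subalgebras r \<noteq> {}}"

lemma pmap_zero: "pmap 0 = 0"
  using pmap_scale[of 0 0] by (simp add: zero_power[OF char_pos])

lemma torus_zero: "torus {0}"
  by (simp add: torus_def p_subalgebra_def bracket_self pmap_zero bij_betw_def)

end

locale fd_restricted_lie_algebra =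
  restricted_lie_algebra scale bracket pmap + finite_dimensional_vector_space scale Basis
  for scale :: "'k::field \<Rightarrow> 'g::ab_group_add \<Rightarrow> 'g"
    and bracket :: "'g \<Rightarrow> 'g \<Rightarrow> 'g" and pmap :: "'g \<Rightarrow> 'g" and Basis :: "'g set"
begin

text \<open>The choice in \<open>num_roots\<close> and the maximum in \<open>p_rank\<close> are well defined.\<close>

lemma Tor_nonempty: "Tor \<noteq> {}"
proof -
  let ?D = "dim ` {V. torus V}"
  have fin: "finite ?D"
    by (rule finite_subset[of _ "{..dimension}"]) (auto intro: dim_subset_UNIV)
  have "?D \<noteq> {}"
    using torus_zero by blast
  with fin have "Max ?D \<in> ?D"
    by (rule Max_in)
  then obtain V where "torus V" "dim V = Max ?D"
    by auto
  then have "V \<in> Tor"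
    using fin by (auto simp: Tor_def intro: Max_ge)
  then show ?thesis
    by blast
qed

lemma p_rank_set:
  "finite {r. elementary_subalgebras r \<noteq> {}}" "{r. elementary_subalgebras r \<noteq> {}} \<noteq> {}"
proof -
  show "finite {r. elementary_subalgebras r \<noteq> {}}"
    by (rule finite_subset[of _ "{..dimension}"])
      (auto simp: elementary_subalgebras_def intro: dim_subset_UNIV)
  have "{0} \<in> elementary_subalgebras (dim {0})"
    by (simp add: elementary_subalgebras_def bracket_self pmap_zero)
  then show "{r. elementary_subalgebras r \<noteq> {}} \<noteq> {}"
    by blast
qed

end

end

(* The proof works in the centralizer C of a null vector z that centralizes the given torus T of
   maximal dimension; such a z exists unless T is self-centralizing. As the p-rank is one, the null
   vectors of C form the line kz, and every root of T still has a root vector in C. On an abelian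
   p-subalgebra of C (or one of class two) the p-map is therefore a semilinear map with kernel in a
   line, so its image has codimension at most one; but p-th powers of root vectors have weight zero.
   Hence C contains no two independent commuting root vectors, nor root vectors e, f spanning a
   Heisenberg algebra with [e, f]; a similar count, using the nilpotent conjugates of e, excludes sl_2.
   Two roots produce, by following root strings on which no bracket can vanish, root vectors
   e and f of opposite weights with [e, [e, f]] a multiple of e, and these span one of the excluded
   algebras. *)

theory Submission
  imports Defs
begin

text \<open>The obstacle is that zero-weight vectors are not known to act on root vectors by
  scalars, so [e, h] = 0 for a zero-weight h says nothing by itself about [f, h] when f has the
  opposite weight. The p-map fills this gap: in the abelian p-subalgebra generated by e and h, the
  vector e and the image of the p-map span everything. Iterating this writes h as a combination of
  iterated p-th powers of e plus an element of T, and both parts can be controlled on f. The prime p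
  also governs the strings. Adding \<alpha> to a weight p times leads back to it, but (ad e)^p = ad
  e^[p], so a string that starts at a vector killed by ad e^[p] cannot complete a round. On the
  multiples of \<alpha> the only steps that can fail are those leaving the weights 0 and \<alpha>.
  Hence [e, [e, f]] commutes with e when f is the member of the string of weight -\<alpha>, and
  being of weight \<alpha> it is a multiple of e. Algebraic closedness provides the p-th roots that
  make images of semilinear maps subspaces, and the root of the quadratic equation that selects the
  conjugate of e in the sl_2 case.\<close>

lemma funpow_last_nonzero:
  assumes "(f ^^ n) x = 0" and "x \<noteq> (0 :: 'a :: zero)"
  obtains m where "(f ^^ m) x \<noteq> 0" "f ((f ^^ m) x) = 0"
proof -
  have "\<exists>m. (f ^^ m) x \<noteq> 0 \<and> (f ^^ Suc m) x = 0"
    using assms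
  proof (induction n)
    case (Suc n)
    then show ?case by (cases "(f ^^ n) x = 0") blast+
  qed simp
  then show ?thesis
    using that by auto
qed

lemma funpow_mem_invariant:
  assumes "x \<in> A" and "\<And>y. y \<in> A \<Longrightarrow> f y \<in> A"
  shows "(f ^^ n) x \<in> A"
  using assms by (induction n) auto

section \<open>Bracket identities and Jacobson's terms\<close>

context lie_algebra
begin

lemma bracket_add_right: "bracket x (y + z) = bracket x y + bracket x z"
  and bracket_diff_right: "bracket x (y - z) = bracket x y - bracket x z"
  and bracket_minus_right: "bracket x (- y) = - bracket x y"
  and bracket_scale_right: "bracket x (scale c y) = scale c (bracket x y)"
  and bracket_zero_right: "bracket x 0 = 0"
  using linear_bracket_right[of x]
  by (simp_all add: linear_iff_module_hom module_hom.add module_hom.diff module_hom.neg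
      module_hom.scale module_hom.zero)

lemma bracket_add_left: "bracket (x + y) z = bracket x z + bracket y z"
  and bracket_diff_left: "bracket (x - y) z = bracket x z - bracket y z"
  and bracket_minus_left: "bracket (- x) z = - bracket x z"
  and bracket_scale_left: "bracket (scale c x) z = scale c (bracket x z)"
  and bracket_zero_left: "bracket 0 z = 0"
proof -
  note hom = linear_bracket_left[of z, unfolded linear_iff_module_hom]
  show "bracket (x + y) z = bracket x z + bracket y z"
    by (rule module_hom.add[OF hom])
  show "bracket (x - y) z = bracket x z - bracket y z"
    by (rule module_hom.diff[OF hom])
  show "bracket (- x) z = - bracket x z"
    by (rule module_hom.neg[OF hom])
  show "bracket (scale c x) z = scale c (bracket x z)"
    by (rule module_hom.scale[OF hom])
  show "bracket 0 z = 0"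
    by (rule module_hom.zero[OF hom])
qed

lemmas bracket_simps =
  bracket_add_right bracket_diff_right bracket_minus_right bracket_scale_right bracket_zero_right
  bracket_add_left bracket_diff_left bracket_minus_left bracket_scale_left bracket_zero_left
  bracket_self

lemma bracket_skew: "bracket x y = - bracket y x"
proof -
  have "0 = bracket (x + y) (x + y)"
    by (simp only: bracket_self)
  also have "\<dots> = bracket x y + bracket y x"
    by (simp only: bracket_add_left bracket_add_right) (simp add: bracket_self)
  finally show ?thesis
    by (simp add: eq_neg_iff_add_eq_0)
qed

lemma bracket_commute_zero: "bracket x y = 0 \<longleftrightarrow> bracket y x = 0"
  using bracket_skew[of x y] by simp

lemma bracket_leibniz: "bracket x (bracket y z) = bracket (bracket x y) z + bracket y (bracket x z)"
proof -
  have "bracket y (bracket z x) = - bracket y (bracket x z)"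
    "bracket z (bracket x y) = - bracket (bracket x y) z"
    by (simp_all add: bracket_skew[of z] bracket_minus_right)
  then show ?thesis
    using jacobi[of x y z] by (simp add: algebra_simps)
qed

lemma subspace_commutant: "subspace {y. bracket x y = 0}"
  by (auto simp: subspace_def bracket_simps)

lemma span_bracket_zero:
  assumes "\<And>x. x \<in> S \<Longrightarrow> bracket y x = 0" and "x \<in> span S"
  shows "bracket y x = 0"
  using span_minimal[OF _ subspace_commutant, of S y] assms by blast

lemma span_bracket_closed:
  assumes "\<And>a b. a \<in> S \<Longrightarrow> b \<in> S \<Longrightarrow> bracket a b \<in> span S" and "x \<in> span S" "y \<in> span S"
  shows "bracket x y \<in> span S"
proof -
  have left: "bracket a y \<in> span S" if "a \<in> S" for a
  proof -
    have "subspace {y. bracket a y \<in> span S}"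
      by (auto simp: subspace_def bracket_simps span_zero span_add span_scale)
    then have "span S \<subseteq> {y. bracket a y \<in> span S}"
      using assms(1) that by (intro span_minimal) auto
    then show ?thesis
      using assms(3) by blast
  qed
  have "subspace {x. bracket x y \<in> span S}"
    by (auto simp: subspace_def bracket_simps span_zero span_add span_scale)
  then have "span S \<subseteq> {x. bracket x y \<in> span S}"
    using left by (intro span_minimal) auto
  then show ?thesis
    using assms(2) by blast
qed

lemma funpow_bracket_weight:
  assumes "bracket x y = scale c y"
  shows "(bracket x ^^ n) y = scale (c ^ n) y"
  by (induction n) (simp_all add: assms bracket_simps mult.commute)

lemma funpow_bracket_zero: "(bracket x ^^ n) 0 = 0"
  by (induction n) (simp_all add: bracket_simps)

lemma funpow_bracket_eq_zero:
  assumes "(bracket x ^^ m) y = 0" and "m \<le> n"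
  shows "(bracket x ^^ n) y = 0"
proof -
  obtain k where "n = k + m"
    using assms(2) by (metis add.commute le_add_diff_inverse)
  then show ?thesis
    by (simp add: funpow_add assms funpow_bracket_zero)
qed

lemma coeff_ad_pencil:
  "coeff (ad_pencil x y f) n =
     (case n of 0 \<Rightarrow> 0 | Suc m \<Rightarrow> bracket x (coeff f m)) + bracket y (coeff f n)"
  by (cases n) (simp_all add: ad_pencil_def coeff_map_poly bracket_simps)

text \<open>The coefficients of the iterated pencil are sums of iterated brackets of
  \<open>x\<close> and \<open>y\<close>, so they stay in any subalgebra containing both.\<close>

lemma jacobson_term_mem:
  assumes S: "subspace S" and "x \<in> S" "y \<in> S"
    and closed: "\<And>a b. a \<in> S \<Longrightarrow> b \<in> S \<Longrightarrow> bracket a b \<in> S"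
  shows "jacobson_term i x y \<in> S"
proof -
  have "coeff ((ad_pencil x y ^^ k) [:x:]) n \<in> S" for k n
  proof (induction k arbitrary: n)
    case 0
    show ?case
      using S \<open>x \<in> S\<close> by (cases n) (auto simp: subspace_0)
  next
    case (Suc k)
    show ?case
      using S Suc assms
      by (auto simp: coeff_ad_pencil subspace_add subspace_0 split: nat.split)
  qed
  then show ?thesis
    using S by (simp add: jacobson_term_def subspace_scale)
qed

text \<open>The first application of the pencil to \<open>[:x:]\<close> leaves only the constant
  \<open>bracket y x\<close>, and the second one kills it. Since p is at least 3, at least two of
  the p - 1 applications are available.\<close>

lemma jacobson_term_zero:
  assumes "CHAR('k) \<ge> 3" and "bracket x (bracket y x) = 0" and "bracket y (bracket y x) = 0"
  shows "jacobson_term i x y = 0"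
proof -
  have two: "ad_pencil x y (ad_pencil x y [:x:]) = 0"
    by (rule poly_eqI) (auto simp: coeff_ad_pencil bracket_simps assms coeff_pCons split: nat.split)
  have zero: "(ad_pencil x y ^^ k) 0 = 0" for k
    by (induction k) (auto simp: ad_pencil_def)
  obtain k where k: "CHAR('k) - 1 = Suc (Suc k)"
    using assms(1) by (metis numeral_3_eq_3 diff_Suc_1 Suc_le_D Suc_le_mono)
  show ?thesis
    unfolding jacobson_term_def k funpow_Suc_right by (simp add: two zero)
qed

end

section \<open>Additivity of the p-map and p-subalgebras generated by commuting elements\<close>

context restricted_lie_algebra
begin

lemma pmap_add_mod:
  assumes "subspace S" "x \<in> S" "y \<in> S" "\<And>a b. a \<in> S \<Longrightarrow> b \<in> S \<Longrightarrow> bracket a b \<in> S"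
  obtains s where "s \<in> S" "pmap (x + y) = pmap x + pmap y + s"
proof (rule that)
  show "(\<Sum>i = 1..CHAR('k) - 1. jacobson_term i x y) \<in> S"
    using assms by (intro subspace_sum jacobson_term_mem)
qed (rule pmap_add)

lemma pmap_add_class2:
  assumes "CHAR('k) \<ge> 3" and "bracket x (bracket y x) = 0" and "bracket y (bracket y x) = 0"
  shows "pmap (x + y) = pmap x + pmap y"
  by (simp add: pmap_add jacobson_term_zero[OF assms])

lemma pmap_add_commuting:
  assumes "CHAR('k) \<ge> 3" and "bracket x y = 0"
  shows "pmap (x + y) = pmap x + pmap y"
  using assms bracket_commute_zero[of x y] by (intro pmap_add_class2) (simp_all add: bracket_simps)

lemma bracket_pmap_eq_zero:
  assumes "bracket x y = 0"
  shows "bracket (pmap x) y = 0"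
  using funpow_bracket_eq_zero[of 1 x y "CHAR('k)"] assms char_pos
  by (simp add: bracket_pmap)

lemma bracket_pmap_right_eq_zero:
  assumes "bracket y x = 0"
  shows "bracket y (pmap x) = 0"
  using assms bracket_pmap_eq_zero[of x y] by (simp add: bracket_commute_zero[of y])

lemma bracket_funpow_pmap_right_eq_zero:
  assumes "bracket y x = 0"
  shows "bracket y ((pmap ^^ n) x) = 0"
  by (induction n) (simp_all add: assms bracket_pmap_right_eq_zero)

lemma bracket_funpow_pmap: "bracket ((pmap ^^ n) x) = bracket x ^^ (CHAR('k) ^ n)"
proof (induction n)
  case (Suc n)
  have "bracket ((pmap ^^ Suc n) x) = (bracket x ^^ (CHAR('k) ^ n)) ^^ CHAR('k)"
    by (simp add: bracket_pmap Suc)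
  then show ?case
    by (simp add: funpow_mult mult.commute)
qed simp

text \<open>For p at least 3 and a commuting set \<open>S\<close> this is the p-subalgebra generated
  by \<open>S\<close>. In general it is only a linear span, closed under neither
  \<open>bracket\<close> nor \<open>pmap\<close>.\<close>

definition p_span :: "'g set \<Rightarrow> 'g set" where
  "p_span S = span {(pmap ^^ i) x | i x. x \<in> S}"

lemma subspace_p_span: "subspace (p_span S)"
  by (simp add: p_span_def)

lemma p_span_base: "x \<in> S \<Longrightarrow> x \<in> p_span S"
proof -
  assume "x \<in> S"
  then have "(pmap ^^ 0) x \<in> p_span S"
    unfolding p_span_def by (intro span_base) blast
  then show ?thesis
    by simp
qed

lemma p_span_subset:
  assumes "S \<subseteq> A" "subspace A" "\<And>x. x \<in> A \<Longrightarrow> pmap x \<in> A"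
  shows "p_span S \<subseteq> A"
  unfolding p_span_def
  using assms by (intro span_minimal) (auto intro: funpow_mem_invariant)

lemma p_span_bracket_zero:
  assumes "\<And>x. x \<in> S \<Longrightarrow> bracket y x = 0" and "x \<in> p_span S"
  shows "bracket y x = 0"
proof -
  have "p_span S \<subseteq> {x. bracket y x = 0}"
    by (rule p_span_subset[OF _ subspace_commutant]) (auto simp: assms(1) bracket_pmap_right_eq_zero)
  then show ?thesis
    using assms(2) by blast
qed

lemma p_span_abelian:
  assumes "\<And>x y. x \<in> S \<Longrightarrow> y \<in> S \<Longrightarrow> bracket x y = 0" and "x \<in> p_span S" "y \<in> p_span S"
  shows "bracket x y = 0"
proof (rule p_span_bracket_zero[OF _ assms(3)])
  fix u assume "u \<in> S"
  then have "bracket u x = 0"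
    using p_span_bracket_zero[OF assms(1,2)] by simp
  then show "bracket x u = 0"
    by (simp add: bracket_commute_zero)
qed

text \<open>On commuting elements the p-map is semilinear and shifts each generator one power up.
  The smaller target matters: if \<open>S\<close> consists of weight vectors, its p-th powers and
  all that they generate have weight zero.\<close>

lemma pmap_p_span_image:
  assumes "CHAR('k) \<ge> 3" and S: "\<And>x y. x \<in> S \<Longrightarrow> y \<in> S \<Longrightarrow> bracket x y = 0"
    and x: "x \<in> p_span S"
  shows "pmap x \<in> p_span (pmap ` S)"
proof -
  \<comment> \<open>Membership is carried through the induction because additivity needs the two
    summands to commute.\<close>
  have "x \<in> p_span S \<and> pmap x \<in> p_span (pmap ` S)"
    using x unfolding p_span_def[of S]
  proof (induction x rule: span_induct_alt)
    case base
    show ?case by (simp add: pmap_zero span_zero subspace_0 subspace_p_span)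
  next
    case (step c x y)
    then obtain i u where u: "x = (pmap ^^ i) u" "u \<in> S"
      by auto
    have "x \<in> p_span S"
      unfolding p_span_def by (rule span_base) fact
    moreover have "pmap x \<in> p_span (pmap ` S)"
      unfolding p_span_def using u by (intro span_base) (auto simp: funpow_swap1)
    ultimately show ?case
      using step p_span_abelian[of S "scale c x" y] S
      by (fold p_span_def)
        (auto simp: pmap_add_commuting assms(1) subspace_add subspace_scale pmap_scale subspace_p_span)
  qed
  then show ?thesis ..
qed

lemma p_span_image_subset: "p_span (pmap ` S) \<subseteq> p_span S"
  unfolding p_span_def
proof (intro span_mono subsetI)
  fix x assume "x \<in> {(pmap ^^ i) x | i x. x \<in> pmap ` S}"
  then obtain i u where "x = (pmap ^^ Suc i) u" "u \<in> S"
    by (auto simp: funpow_swap1)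
  then show "x \<in> {(pmap ^^ i) x | i x. x \<in> S}"
    by blast
qed

lemma pmap_p_span:
  assumes "CHAR('k) \<ge> 3" and "\<And>x y. x \<in> S \<Longrightarrow> y \<in> S \<Longrightarrow> bracket x y = 0" and "x \<in> p_span S"
  shows "pmap x \<in> p_span S"
  using pmap_p_span_image[OF assms] p_span_image_subset by blast

end

section \<open>Semilinear endomorphisms\<close>

text \<open>The axioms are confined to a subspace \<open>U\<close>, since the p-map is additive only
  on suitable subspaces of the Lie algebra.\<close>

locale semilinear_endomorphism = finite_dimensional_vector_space scale Basis
  for scale :: "'k::alg_closed_field \<Rightarrow> 'g::ab_group_add \<Rightarrow> 'g" and Basis :: "'g set" +
  fixes \<phi> :: "'g \<Rightarrow> 'g" and U :: "'g set" and q :: nat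
  assumes q_pos: "q > 0"
    and subspace_U: "subspace U"
    and phi_mem: "x \<in> U \<Longrightarrow> \<phi> x \<in> U"
    and phi_add: "x \<in> U \<Longrightarrow> y \<in> U \<Longrightarrow> \<phi> (x + y) = \<phi> x + \<phi> y"
    and phi_scale: "x \<in> U \<Longrightarrow> \<phi> (scale c x) = scale (c ^ q) (\<phi> x)"
begin

lemma phi_zero: "\<phi> 0 = 0"
  using phi_scale[of 0 0] q_pos subspace_0[OF subspace_U] by (simp add: zero_power)

lemma phi_diff:
  assumes "x \<in> U" "y \<in> U"
  shows "\<phi> (x - y) = \<phi> x - \<phi> y"
  using phi_add[of "x - y" y] assms subspace_diff[OF subspace_U, of x y] by (simp add: algebra_simps)

lemma subspace_phi_image:
  assumes "subspace V" "V \<subseteq> U"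
  shows "subspace (\<phi> ` V)"
proof (rule subspaceI)
  show "0 \<in> \<phi> ` V"
    using subspace_0[OF assms(1)] phi_zero by (metis image_eqI)
  show "x + y \<in> \<phi> ` V" if xy: "x \<in> \<phi> ` V" "y \<in> \<phi> ` V" for x y
  proof -
    obtain a b where "a \<in> V" "b \<in> V" "x = \<phi> a" "y = \<phi> b"
      using xy by auto
    then show ?thesis
      using assms phi_add[of a b] subspace_add[of V a b] by (metis image_eqI subsetD)
  qed
  show "scale c x \<in> \<phi> ` V" if x: "x \<in> \<phi> ` V" for c x
  proof -
    obtain a where a: "a \<in> V" "x = \<phi> a"
      using x by auto
    \<comment> \<open>Semilinearity twists scalars by the power \<open>q\<close>, so a multiple of
      an image is again an image only after a \<open>q\<close>-th root is extracted.\<close>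
    obtain d where "d ^ q = c"
      using nth_root_exists[OF q_pos, of c] by blast
    then show ?thesis
      using assms a phi_scale[of a d] subspace_scale[of V a d] by (metis image_eqI subsetD)
  qed
qed

lemma phi_image_span_subset:
  assumes "G \<subseteq> U" "x \<in> span G"
  shows "\<phi> x \<in> span (\<phi> ` G)"
proof -
  have "x \<in> U \<and> \<phi> x \<in> span (\<phi> ` G)"
    using assms(2)
  proof (induction x rule: span_induct_alt)
    case base
    show ?case
      by (simp add: phi_zero span_zero subspace_0 subspace_U)
  next
    case (step c x y)
    then have x: "x \<in> U" "\<phi> x \<in> span (\<phi> ` G)"
      using assms(1) by (auto intro: span_base)
    then have cx: "scale c x \<in> U"
      by (simp add: subspace_scale subspace_U)
    then show ?case
      using step x by (simp add: phi_add phi_scale span_add span_scale subspace_add subspace_U)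
  qed
  then show ?thesis ..
qed

lemma span_subset_phi_image_span:
  assumes "G \<subseteq> U"
  shows "span (\<phi> ` G) \<subseteq> \<phi> ` span G"
proof (rule span_minimal)
  show "\<phi> ` G \<subseteq> \<phi> ` span G"
    by (rule image_mono) (rule span_superset)
  show "subspace (\<phi> ` span G)"
    using assms by (intro subspace_phi_image span_minimal subspace_U subspace_span)
qed

text \<open>Rank-nullity, valid for semilinear maps because the field is perfect.\<close>

lemma dim_le_Suc_dim_phi_image:
  assumes ker: "\<And>x. x \<in> U \<Longrightarrow> \<phi> x = 0 \<Longrightarrow> x \<in> span {z}"
  shows "dim U \<le> Suc (dim (\<phi> ` U))"
proof -
  obtain B where B: "B \<subseteq> \<phi> ` U" "independent B" "\<phi> ` U \<subseteq> span B" "card B = dim (\<phi> ` U)"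
    by (rule basis_exists)
  obtain G where G: "G \<subseteq> U" "inj_on \<phi> G" "B = \<phi> ` G"
    using B(1) by (auto simp: subset_image_inj)
  have finG: "finite G"
    using finiteI_independent[OF B(2)] G by (auto dest: finite_imageD)
  have GU: "span G \<subseteq> U"
    using G(1) subspace_U by (rule span_minimal)
  have "U \<subseteq> span (insert z G)"
  proof
    fix x assume x: "x \<in> U"
    then have "\<phi> x \<in> \<phi> ` span G"
      using B(3) G span_subset_phi_image_span by blast
    then obtain y where y: "y \<in> span G" "\<phi> x = \<phi> y"
      by auto
    have "\<phi> (x - y) = 0" "x - y \<in> U"
      using x y GU phi_diff[of x y] subspace_diff[OF subspace_U, of x y] by auto
    then have "x - y \<in> span (insert z G)"
      using ker[of "x - y"] span_mono[of "{z}" "insert z G"] by blast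
    moreover have "y \<in> span (insert z G)"
      using y span_mono[of G "insert z G"] by blast
    ultimately show "x \<in> span (insert z G)"
      using span_add[of "x - y" _ y] by simp
  qed
  then have "dim U \<le> card (insert z G)"
    by (rule dim_le_card) (simp add: finG)
  also have "\<dots> \<le> Suc (card G)"
    by (simp add: card_insert_if finG)
  also have "card G = dim (\<phi> ` U)"
    using B(4) G by (simp add: card_image)
  finally show ?thesis .
qed

text \<open>The image has codimension at most one in \<open>U\<close>, so any single vector
  \<open>e\<close> outside it completes it to \<open>U\<close>. All later exclusions rest on this
  decomposition.\<close>

lemma span_insert_phi_image:
  assumes ker: "\<And>x. x \<in> U \<Longrightarrow> \<phi> x = 0 \<Longrightarrow> x \<in> span {z}"
    and e: "e \<in> U" "e \<notin> \<phi> ` U" and f: "f \<in> U"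
  obtains c y where "y \<in> U" "f = scale c e + \<phi> y"
proof -
  have sub: "subspace (\<phi> ` U)"
    using subspace_phi_image[OF subspace_U] by simp
  then have sp: "span (\<phi> ` U) = \<phi> ` U"
    by simp
  have "dim (insert e (\<phi> ` U)) = Suc (dim (\<phi> ` U))"
    using e by (simp add: dim_insert sp)
  moreover have "span (insert e (\<phi> ` U)) \<subseteq> U"
    using e phi_mem by (intro span_minimal subspace_U) auto
  ultimately have "span (insert e (\<phi> ` U)) = U"
    using dim_le_Suc_dim_phi_image[OF ker]
    by (intro subspace_dim_equal subspace_U subspace_span) auto
  then obtain c where "f - scale c e \<in> \<phi> ` U"
    using f span_breakdown_eq[of f e "\<phi> ` U"] sp by auto
  then obtain y where "y \<in> U" "f - scale c e = \<phi> y"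
    by auto
  then show ?thesis
    by (intro that[of y c]) (auto simp: algebra_simps)
qed

text \<open>A nonzero kernel vector could be extended to a basis of \<open>U\<close>; the images of
  the other basis vectors would then generate \<open>U\<close> with too few elements.\<close>

lemma inj_on_if_surj:
  assumes surj: "\<phi> ` U = U"
  shows "inj_on \<phi> U"
proof (rule inj_onI)
  fix a b assume ab: "a \<in> U" "b \<in> U" "\<phi> a = \<phi> b"
  define x where "x = a - b"
  have x: "x \<in> U" "\<phi> x = 0"
    using ab subspace_diff[OF subspace_U] phi_diff by (auto simp: x_def)
  show "a = b"
  proof (rule ccontr)
    assume "a \<noteq> b"
    then have "independent {x}" "{x} \<subseteq> U"
      using x by (auto simp: x_def dependent_single)
    then obtain B where B: "{x} \<subseteq> B" "B \<subseteq> U" "independent B" "U \<subseteq> span B"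
      by (metis maximal_independent_subset_extend)
    have fin: "finite B"
      using B by (intro finiteI_independent)
    have "U \<subseteq> span (\<phi> ` B)"
    proof
      fix y assume "y \<in> U"
      then obtain w where "w \<in> U" "y = \<phi> w"
        using surj by (metis imageE)
      then show "y \<in> span (\<phi> ` B)"
        using phi_image_span_subset[OF B(2), of w] B(4) by auto
    qed
    also have "\<phi> ` B \<subseteq> insert 0 (\<phi> ` (B - {x}))"
      using x by auto
    then have "span (\<phi> ` B) \<subseteq> span (\<phi> ` (B - {x}))"
      by (metis span_insert_0 span_mono)
    finally have "dim U \<le> card (\<phi> ` (B - {x}))"
      using fin by (intro dim_le_card) auto
    also have "\<dots> \<le> card (B - {x})"
      using fin by (intro card_image_le) auto
    also have "\<dots> < card B"
      using fin B(1) by (intro psubset_card_mono) auto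
    also have "card B = dim U"
      using B by (intro basis_card_eq_dim) auto
    finally show False
      by simp
  qed
qed

end

section \<open>The prime field, and p-th powers in the centralizer of a maximal torus\<close>

locale alg_closed_restricted_lie_algebra = fd_restricted_lie_algebra scale bracket pmap Basis
  for scale :: "'k::alg_closed_field \<Rightarrow> 'g::ab_group_add \<Rightarrow> 'g"
    and bracket :: "'g \<Rightarrow> 'g \<Rightarrow> 'g" and pmap :: "'g \<Rightarrow> 'g" and Basis :: "'g set" +
  assumes char_ge_3: "CHAR('k) \<ge> 3"
begin

lemma prime_char: "prime CHAR('k)"
  using prime_CHAR_semidom[where ?'a = 'k] char_pos by simp

lemma of_nat_eq_zero_imp: "of_nat n = (0 :: 'k) \<Longrightarrow> n < CHAR('k) \<Longrightarrow> n = 0"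
  by (auto simp: of_nat_eq_0_iff_char_dvd dest: dvd_imp_le)

lemma two_nonzero: "(2 :: 'k) \<noteq> 0"
  using of_nat_eq_zero_imp[of 2] char_ge_3 by auto

lemma of_nat_power_char: "(of_nat n :: 'k) ^ CHAR('k) = of_nat n"
proof (induction n)
  case (Suc n)
  then show ?case
    by (simp add: freshmans_dream[OF prime_char refl])
qed (simp add: char_pos)

definition prime_field :: "'k set" where
  "prime_field = range of_nat"

lemma prime_field_of_nat: "of_nat n \<in> prime_field"
  by (simp add: prime_field_def)

lemma prime_field_numeral: "numeral n \<in> prime_field" "1 \<in> prime_field"
  using prime_field_of_nat[of "numeral n"] prime_field_of_nat[of 1] by simp_all

lemma prime_field_mult: "a \<in> prime_field \<Longrightarrow> b \<in> prime_field \<Longrightarrow> a * b \<in> prime_field"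
  by (auto simp: prime_field_def simp flip: of_nat_mult)

lemma prime_field_minus:
  assumes "a \<in> prime_field"
  shows "- a \<in> prime_field"
proof -
  have "- 1 = (of_nat (CHAR('k) - 1) :: 'k)"
    using char_pos by (simp add: of_nat_diff)
  then have "- 1 * a \<in> prime_field"
    using assms prime_field_of_nat by (metis prime_field_mult)
  then show ?thesis
    by simp
qed

lemma prime_field_diff: "a \<in> prime_field \<Longrightarrow> b \<in> prime_field \<Longrightarrow> a - b \<in> prime_field"
proof -
  assume "a \<in> prime_field" "b \<in> prime_field"
  then obtain m n where "a = of_nat m" "- b = of_nat n"
    using prime_field_minus[of b] unfolding prime_field_def by blast
  then have "a - b = of_nat (m + n)"
    by (simp add: algebra_simps flip: \<open>- b = of_nat n\<close>)
  then show ?thesis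
    using prime_field_of_nat by metis
qed

text \<open>By Fermat's little theorem a^p = a, so the inverse of a nonzero a is a^(p-2), again the
  image of a natural number.\<close>

lemma prime_field_inverse:
  assumes "a \<in> prime_field"
  shows "inverse a \<in> prime_field"
proof (cases "a = 0")
  case True
  then show ?thesis
    using assms by simp
next
  case False
  obtain n where n: "a = of_nat n"
    using assms by (auto simp: prime_field_def)
  obtain k where k: "CHAR('k) = Suc (Suc k)"
  proof
    show "CHAR('k) = Suc (Suc (CHAR('k) - 2))"
      using char_ge_3 by simp
  qed
  have "a * (a * a ^ k) = a"
    using of_nat_power_char[of n] by (simp add: k n)
  then have "inverse a = a ^ k"
    using False by (intro inverse_unique) simp
  then show ?thesis
    by (simp add: n prime_field_of_nat flip: of_nat_power)
qed

lemma pmap_minus: "pmap (- x) = - pmap x"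
proof -
  have "odd CHAR('k)"
    using prime_char char_ge_3 prime_odd_nat by force
  then show ?thesis
    using pmap_scale[of "- 1" x] by (simp add: scale_minus_left)
qed

lemma pmap_diff_commuting: "bracket x y = 0 \<Longrightarrow> pmap (x - y) = pmap x - pmap y"
  using pmap_add_commuting[OF char_ge_3, of x "- y"] by (simp add: pmap_minus bracket_minus_right)

lemma semilinear_pmap:
  assumes "subspace A" "\<And>x. x \<in> A \<Longrightarrow> pmap x \<in> A"
    and "\<And>x y. x \<in> A \<Longrightarrow> y \<in> A \<Longrightarrow> pmap (x + y) = pmap x + pmap y"
  shows "semilinear_endomorphism scale Basis pmap A CHAR('k)"
  using assms by unfold_locales (auto simp: char_pos pmap_scale)

text \<open>A Fitting argument: the images of \<open>A\<close> under powers of \<open>pmap\<close>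
  decrease, and where the dimension is least \<open>pmap\<close> maps the image onto itself. This
  stable image commutes with \<open>T\<close>, so its sum with \<open>T\<close> is a torus, and
  maximality of \<open>T\<close> forces it into \<open>T\<close>.\<close>

lemma funpow_pmap_mem_max_torus:
  assumes T: "T \<in> Tor" and A: "subspace A" "\<And>x. x \<in> A \<Longrightarrow> pmap x \<in> A" "A \<subseteq> centralizer T"
    and abel: "\<And>x y. x \<in> A \<Longrightarrow> y \<in> A \<Longrightarrow> bracket x y = 0"
  obtains n where "\<And>x. x \<in> A \<Longrightarrow> (pmap ^^ n) x \<in> T"
proof -
  interpret A: semilinear_endomorphism scale Basis pmap A "CHAR('k)"
    using A abel by (intro semilinear_pmap pmap_add_commuting char_ge_3)
  have torT: "torus T"
    using T by (simp add: Tor_def)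
  then have T': "subspace T" "\<And>x. x \<in> T \<Longrightarrow> pmap x \<in> T" "pmap ` T = T"
    "\<And>x y. x \<in> T \<Longrightarrow> y \<in> T \<Longrightarrow> bracket x y = 0"
    by (auto simp: torus_def p_subalgebra_def bij_betw_def)
  define D where "D n = (pmap ^^ n) ` A" for n
  have DA: "D n \<subseteq> A" for n
    using A(2) funpow_mem_invariant[of _ A pmap n] by (auto simp: D_def)
  have D_Suc: "D (Suc n) = pmap ` D n" for n
    by (auto simp: D_def)
  have subD: "subspace (D n)" for n
  proof (induction n)
    case (Suc n)
    then show ?case
      unfolding D_Suc using DA by (rule A.subspace_phi_image)
  qed (simp add: D_def A)
  have D_anti: "D (Suc n) \<subseteq> D n" for n
    unfolding D_def using A(2) by (auto simp: funpow_Suc_right simp del: funpow.simps)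
  obtain n where n: "dim (D n) \<le> dim (D m)" for m
    using ex_has_least_nat[of "\<lambda>_. True" 0 "\<lambda>n. dim (D n)"] by auto
  have surj: "pmap ` D n = D n"
    using subspace_dim_equal[OF subD subD D_anti n] by (simp add: D_Suc)
  have comm: "bracket s y = 0" "bracket y s = 0" if "s \<in> T" "y \<in> D n" for s y
    using that DA A(3) by (auto simp: centralizer_def bracket_commute_zero[of y])
  define W where "W = {s + y | s y. s \<in> T \<and> y \<in> D n}"
  have memW: "s + y \<in> W" if "s \<in> T" "y \<in> D n" for s y
    using that by (auto simp: W_def)
  have pW: "pmap (s + y) = pmap s + pmap y" if "s \<in> T" "y \<in> D n" for s y
    using that comm by (intro pmap_add_commuting char_ge_3)
  have subW: "subspace W"
    unfolding W_def by (rule subspace_sums[OF T'(1) subD])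
  have abelW: "bracket x y = 0" if "x \<in> W" "y \<in> W" for x y
    using that comm T'(4) abel DA by (fastforce simp: W_def bracket_simps)
  have "pmap ` W = W"
  proof (intro equalityI subsetI)
    fix x assume "x \<in> pmap ` W"
    then show "x \<in> W"
      using pW surj T'(2) by (auto simp: W_def) blast
  next
    fix x assume "x \<in> W"
    then obtain s y where sy: "x = s + y" "s \<in> T" "y \<in> D n"
      by (auto simp: W_def)
    then obtain s' y' where "s' \<in> T" "y' \<in> D n" "s = pmap s'" "y = pmap y'"
      using T'(3) surj by (metis imageE)
    then show "x \<in> pmap ` W"
      using sy pW memW by (metis image_eqI)
  qed
  \<comment> \<open>\<open>T\<close> and \<open>D n\<close> may intersect, so injectivity is not
    checked on the summands but deduced from surjectivity.\<close>
  moreover from this interpret W: semilinear_endomorphism scale Basis pmap W "CHAR('k)"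
    using subW abelW by (intro semilinear_pmap pmap_add_commuting char_ge_3) auto
  have "inj_on pmap W"
    using calculation by (rule W.inj_on_if_surj)
  ultimately have "torus W"
    using subW abelW subspace_0[OF subW]
    by (auto simp: torus_def p_subalgebra_def bij_betw_def)
  then have "dim W \<le> dim T"
    using T by (simp add: Tor_def)
  moreover have "T \<subseteq> W"
    using memW[of _ 0] subspace_0[OF subD] by auto
  ultimately have "T = W"
    using T'(1) subW by (intro subspace_dim_equal)
  moreover have "D n \<subseteq> W"
    using memW[of 0] subspace_0[OF T'(1)] by auto
  ultimately show ?thesis
    using that[of n] by (auto simp: D_def)
qed

lemma funpow_pmap_add_commuting:
  assumes "bracket x y = 0"
  shows "(pmap ^^ n) (x + y) = (pmap ^^ n) x + (pmap ^^ n) y"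
proof (induction n)
  case (Suc n)
  have "bracket y ((pmap ^^ n) x) = 0"
    using assms by (intro bracket_funpow_pmap_right_eq_zero) (simp add: bracket_commute_zero[of y])
  then have "bracket ((pmap ^^ n) x) ((pmap ^^ n) y) = 0"
    by (intro bracket_funpow_pmap_right_eq_zero) (simp add: bracket_commute_zero[of _ y])
  then show ?case
    by (simp add: Suc pmap_add_commuting char_ge_3)
qed simp

lemma funpow_pmap_scale: "(pmap ^^ n) (scale c x) = scale (c ^ (CHAR('k) ^ n)) ((pmap ^^ n) x)"
  by (induction n) (simp_all add: pmap_scale flip: power_mult, simp add: mult.commute)

lemma subspace_centralizer: "subspace (centralizer S)"
  by (auto simp: subspace_def centralizer_def bracket_simps)

lemma pmap_centralizer: "x \<in> centralizer S \<Longrightarrow> pmap x \<in> centralizer S"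
  by (simp add: centralizer_def bracket_pmap_right_eq_zero)

lemma ex_funpow_pmap_mem_max_torus:
  assumes "T \<in> Tor" "x \<in> centralizer T"
  obtains n where "(pmap ^^ n) x \<in> T"
proof -
  have comm: "bracket u v = 0" if "u \<in> {x}" "v \<in> {x}" for u v
    using that by (simp add: bracket_self)
  obtain n where n: "\<And>y. y \<in> p_span {x} \<Longrightarrow> (pmap ^^ n) y \<in> T"
  proof (rule funpow_pmap_mem_max_torus[OF assms(1) subspace_p_span[of "{x}"]])
    show "pmap y \<in> p_span {x}" if "y \<in> p_span {x}" for y
      using comm that by (rule pmap_p_span[OF char_ge_3])
    show "p_span {x} \<subseteq> centralizer T"
      using assms by (intro p_span_subset subspace_centralizer) (auto intro: pmap_centralizer)
    show "bracket y w = 0" if "y \<in> p_span {x}" "w \<in> p_span {x}" for y w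
      using comm that by (rule p_span_abelian)
  qed blast
  then show ?thesis
    using that n[OF p_span_base[of x "{x}"]] by simp
qed

end

section \<open>Algebras whose null vectors form a line\<close>

locale line_nullcone = alg_closed_restricted_lie_algebra scale bracket pmap Basis
  for scale :: "'k::alg_closed_field \<Rightarrow> 'g::ab_group_add \<Rightarrow> 'g"
    and bracket :: "'g \<Rightarrow> 'g \<Rightarrow> 'g" and pmap :: "'g \<Rightarrow> 'g" and Basis :: "'g set" +
  fixes T :: "'g set" and z :: 'g
  assumes T_max: "T \<in> Tor"
    and z_centralizes: "z \<in> centralizer T"
    and null_line: "bracket z x = 0 \<Longrightarrow> pmap x = 0 \<Longrightarrow> x \<in> span {z}"
begin

text \<open>These are weight spaces inside the centralizer of \<open>z\<close>. The index is an
  arbitrary function of which only the values on \<open>T\<close> matter, so sums and multiples of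
  weights can be written pointwise without restricting them to \<open>T\<close>.\<close>

definition weight :: "('g \<Rightarrow> 'k) \<Rightarrow> 'g set" where
  "weight \<gamma> = {x. bracket z x = 0 \<and> (\<forall>s\<in>T. bracket s x = scale (\<gamma> s) x)}"

abbreviation zero_weight :: "'g set" where
  "zero_weight \<equiv> weight (\<lambda>_. 0)"

lemma weight_cong: "(\<And>s. s \<in> T \<Longrightarrow> \<gamma> s = \<delta> s) \<Longrightarrow> weight \<gamma> = weight \<delta>"
  by (auto simp: weight_def)

lemma subspace_weight: "subspace (weight \<gamma>)"
  by (auto simp: subspace_def weight_def bracket_simps scale_right_distrib scale_left_commute)

lemma z_mem_zero_weight: "z \<in> zero_weight"
  using z_centralizes by (simp add: weight_def centralizer_def bracket_self)

lemma span_z_subset: "span {z} \<subseteq> zero_weight"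
  using z_mem_zero_weight by (intro span_minimal subspace_weight) auto

lemma zero_weight_subset: "zero_weight \<subseteq> centralizer T"
  by (auto simp: weight_def centralizer_def)

lemma weight_commutes: "x \<in> weight \<gamma> \<Longrightarrow> bracket z x = 0"
  by (simp add: weight_def)

lemma weight_bracket:
  assumes "x \<in> weight \<gamma>" "y \<in> weight \<delta>"
  shows "bracket x y \<in> weight (\<lambda>s. \<gamma> s + \<delta> s)"
proof -
  have "bracket z (bracket x y) = 0"
    using assms by (simp add: bracket_leibniz[of z] weight_commutes bracket_simps)
  moreover have "bracket s (bracket x y) = scale (\<gamma> s + \<delta> s) (bracket x y)" if "s \<in> T" for s
    using assms that by (simp add: bracket_leibniz[of s] weight_def bracket_simps scale_left_distrib)
  ultimately show ?thesis
    by (simp add: weight_def)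
qed

lemma weight_bracket_eq:
  assumes "x \<in> weight \<gamma>" "y \<in> weight \<delta>" "\<And>s. s \<in> T \<Longrightarrow> \<gamma> s + \<delta> s = \<epsilon> s"
  shows "bracket x y \<in> weight \<epsilon>"
  using weight_bracket[OF assms(1,2)] weight_cong[of "\<lambda>s. \<gamma> s + \<delta> s" \<epsilon>] assms(3) by simp

text \<open>For s in \<open>T\<close> the bracket [x, s] is a multiple of x, so (ad x)^2, and with
  it (ad x)^p, kills s.\<close>

lemma pmap_weight:
  assumes "x \<in> weight \<gamma>"
  shows "pmap x \<in> zero_weight"
proof -
  have "bracket (pmap x) s = 0" if "s \<in> T" for s
  proof -
    have "bracket x s = scale (- \<gamma> s) x"
      using assms that bracket_skew[of x s] by (simp add: weight_def)
    then have "(bracket x ^^ 2) s = 0"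
      by (simp add: numeral_2_eq_2 bracket_simps)
    then show ?thesis
      using char_ge_3 by (simp add: bracket_pmap funpow_bracket_eq_zero[of 2])
  qed
  then show ?thesis
    using assms by (simp add: weight_def bracket_pmap_right_eq_zero bracket_commute_zero[of _ "pmap x"])
qed

lemma weight_zero:
  assumes "x \<in> weight \<gamma>" "x \<in> zero_weight" "s \<in> T" "\<gamma> s \<noteq> 0"
  shows "x = 0"
  using assms by (auto simp: weight_def)

lemma weight_proportional:
  assumes "e \<in> weight \<gamma>" "f \<in> weight \<delta>" "s \<in> T" "\<delta> s \<noteq> 0" and "f - scale c e \<in> zero_weight"
  shows "\<exists>c. f = scale c e"
proof -
  have "bracket s (f - scale c e) = 0"
    using assms by (simp add: weight_def)
  then have "scale (\<delta> s) f = scale (c * \<gamma> s) e"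
    using assms by (simp add: weight_def bracket_simps)
  then have "scale (inverse (\<delta> s)) (scale (\<delta> s) f) = scale (inverse (\<delta> s)) (scale (c * \<gamma> s) e)"
    by simp
  then have "f = scale (inverse (\<delta> s) * (c * \<gamma> s)) e"
    using assms(4) by simp
  then show ?thesis
    by blast
qed

text \<open>
  On the span of \<open>e\<close>, \<open>f\<close> and the abelian \<open>p\<close>-subalgebra generated by \<open>[e, f]\<close> and the \<open>p\<close>-th powers
  of \<open>e\<close> and \<open>f\<close>, the \<open>p\<close>-map is semilinear with kernel in a line, hence its image has
  codimension at most one. But the image lies in the zero weight space.
\<close>

lemma heisenberg_proportional:
  assumes e: "e \<in> weight \<gamma>" "e \<noteq> 0" "s \<in> T" "\<gamma> s \<noteq> 0"
    and f: "f \<in> weight \<delta>" "s' \<in> T" "\<delta> s' \<noteq> 0"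
    and h: "bracket e f \<in> zero_weight" "bracket e (bracket e f) = 0" "bracket f (bracket e f) = 0"
  shows "\<exists>c. f = scale c e"
proof -
  define h where "h = bracket e f"
  note h = h[folded h_def]
  define S where "S = {pmap e, pmap f, h}"
  have fe: "bracket f e = - h"
    using bracket_skew[of f e] by (simp add: h_def)
  \<comment> \<open>Squares that vanish make the p-th powers vanish too: the p-th power of each of
    \<open>e\<close> and \<open>f\<close> commutes with the other vector.\<close>
  have "(bracket e ^^ 2) f = 0" "(bracket f ^^ 2) e = 0"
    using h by (simp_all add: numeral_2_eq_2 h_def[symmetric] fe bracket_simps)
  then have Ef: "bracket (pmap e) f = 0" and Fe: "bracket (pmap f) e = 0"
    using char_ge_3 by (simp_all add: bracket_pmap funpow_bracket_eq_zero[of 2])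
  note sym = bracket_commute_zero[THEN iffD1]
  have eS: "bracket e x = 0" and fS: "bracket f x = 0" if "x \<in> S" for x
    using that h sym[OF Ef] sym[OF Fe]
    by (auto simp: S_def bracket_self intro: bracket_pmap_right_eq_zero)
  have EF: "bracket (pmap e) (pmap f) = 0"
    using Ef by (rule bracket_pmap_right_eq_zero)
  have hE: "bracket (pmap e) h = 0" "bracket (pmap f) h = 0"
    using h by (auto intro: bracket_pmap_eq_zero)
  have comm: "bracket x y = 0" if "x \<in> S" "y \<in> S" for x y
    using that EF sym[OF EF] hE hE[THEN sym] by (auto simp: S_def bracket_self)
  define A where "A = p_span S"
  have A: "subspace A"
    by (simp add: A_def subspace_p_span)
  have pA: "pmap x \<in> A" if "x \<in> A" for x
    using pmap_p_span[OF char_ge_3 comm] that by (simp add: A_def)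
  have SA: "pmap e \<in> A" "pmap f \<in> A" "h \<in> A"
    by (simp_all add: A_def S_def p_span_base)
  have A0: "A \<subseteq> zero_weight"
    unfolding A_def using h e f
    by (intro p_span_subset subspace_weight) (auto simp: S_def intro: pmap_weight)
  have eA: "bracket e x = 0" "bracket x e = 0" and fA: "bracket f x = 0" "bracket x f = 0"
    if "x \<in> A" for x
    using p_span_bracket_zero[of S e x] p_span_bracket_zero[of S f x] eS fS that sym[of e x] sym[of f x]
    by (auto simp: A_def)
  have AA: "bracket x y = 0" if "x \<in> A" "y \<in> A" for x y
    using p_span_abelian[OF comm] that by (simp add: A_def)
  define U where "U = {scale a e + scale b f + x | a b x. x \<in> A}"
  have memU: "scale a e + scale b f + x \<in> U" if "x \<in> A" for a b x
    using that by (auto simp: U_def)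
  have U: "subspace U"
  proof (rule subspaceI)
    show "0 \<in> U"
      using memU[of 0 0 0] A by (simp add: subspace_0)
    show "x + y \<in> U" if xy: "x \<in> U" "y \<in> U" for x y
    proof -
      obtain a b u a' b' u' where "x = scale a e + scale b f + u" "y = scale a' e + scale b' f + u'"
        "u \<in> A" "u' \<in> A"
        using xy by (auto simp: U_def)
      then show ?thesis
        using memU[of "u + u'" "a + a'" "b + b'"] A
        by (simp add: subspace_add scale_left_distrib algebra_simps)
    qed
    show "scale c x \<in> U" if x: "x \<in> U" for c x
    proof -
      obtain a b u where "x = scale a e + scale b f + u" "u \<in> A"
        using x by (auto simp: U_def)
      then show ?thesis
        using memU[of "scale c u" "c * a" "c * b"] A by (simp add: subspace_scale scale_right_distrib)
    qed
  qed
  have UU: "\<exists>c. bracket x y = scale c h" if "x \<in> U" "y \<in> U" for x y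
  proof -
    obtain a b u a' b' u' where "x = scale a e + scale b f + u" "y = scale a' e + scale b' f + u'"
      "u \<in> A" "u' \<in> A"
      using \<open>x \<in> U\<close> \<open>y \<in> U\<close> by (auto simp: U_def)
    then have "bracket x y = scale (a * b' - b * a') h"
      by (simp add: bracket_simps eA fA AA fe h_def[symmetric] scale_left_diff_distrib mult.commute)
    then show ?thesis ..
  qed
  have Uh: "bracket x h = 0" if "x \<in> U" for x
    using that SA by (auto simp: U_def bracket_simps eA fA AA)
  \<comment> \<open>All brackets in \<open>U\<close> are multiples of \<open>h\<close>, which is
    central in \<open>U\<close>; in class two Jacobson's terms vanish.\<close>
  have addU: "pmap (x + y) = pmap x + pmap y" if "x \<in> U" "y \<in> U" for x y
  proof -
    obtain c where "bracket y x = scale c h"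
      using UU \<open>x \<in> U\<close> \<open>y \<in> U\<close> by blast
    then show ?thesis
      using Uh that by (intro pmap_add_class2 char_ge_3) (simp_all add: bracket_simps)
  qed
  have pU: "pmap x \<in> A" if "x \<in> U" for x
  proof -
    obtain a b u where x: "x = scale a e + scale b f + u" "u \<in> A"
      using \<open>x \<in> U\<close> by (auto simp: U_def)
    have "scale a e \<in> U" "scale b f \<in> U" "u \<in> U" "scale a e + scale b f \<in> U"
      using memU[of 0 a 0] memU[of 0 0 b] memU[of u 0 0] memU[of 0 a b] x subspace_0[OF A] by simp_all
    then have "pmap x = scale (a ^ CHAR('k)) (pmap e) + scale (b ^ CHAR('k)) (pmap f) + pmap u"
      by (simp add: x addU pmap_scale)
    then show ?thesis
      using x SA pA A by (simp add: subspace_add subspace_scale)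
  qed
  have AU: "A \<subseteq> U"
    using memU[of _ 0 0] by auto
  interpret U: semilinear_endomorphism scale Basis pmap U "CHAR('k)"
    using U addU pU AU by (intro semilinear_pmap) auto
  have zU: "bracket z x = 0" if "x \<in> U" for x
    using that A0 e(1) f(1) by (auto simp: U_def bracket_simps weight_commutes dest: subsetD)
  have "e \<in> U" "f \<in> U"
    using memU[of 0 1 0] memU[of 0 0 1] subspace_0[OF A] by simp_all
  moreover have "e \<notin> pmap ` U"
    using pU A0 weight_zero[OF e(1) _ e(3,4)] e(2) by blast
  ultimately obtain c y where y: "y \<in> U" "f = scale c e + pmap y"
    using U.span_insert_phi_image[of z e f] null_line zU by metis
  then have "f - scale c e \<in> zero_weight"
    using pU A0 by auto
  then show ?thesis
    using weight_proportional e(1) f by blast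
qed

text \<open>Let A be the abelian p-subalgebra generated by \<open>e\<close> and \<open>h\<close>. As
  \<open>e\<close> is not a p-th power in A, each element of A is a multiple of \<open>e\<close>
  plus a p-th power. Iterating, \<open>h\<close> becomes a combination of iterated p-th powers of
  \<open>e\<close>, which commute with \<open>f\<close> by hypothesis, plus an element of
  \<open>T\<close>. The latter commutes with \<open>e\<close>, so \<gamma> and therefore \<delta>
  vanish on it, and it commutes with \<open>f\<close>.\<close>

lemma zero_weight_commutes:
  assumes e: "e \<in> weight \<gamma>" "e \<noteq> 0" "s \<in> T" "\<gamma> s \<noteq> 0"
    and f: "f \<in> weight \<delta>" "\<And>s. s \<in> T \<Longrightarrow> \<gamma> s = 0 \<Longrightarrow> \<delta> s = 0" "bracket (pmap e) f = 0"
    and h: "h \<in> zero_weight" "bracket e h = 0"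
  shows "bracket f h = 0"
proof -
  define S where "S = {e, h}"
  have comm: "bracket x y = 0" if "x \<in> S" "y \<in> S" for x y
    using that h bracket_commute_zero[of h e] by (auto simp: S_def bracket_self)
  define A where "A = p_span S"
  have A: "subspace A"
    by (simp add: A_def subspace_p_span)
  have pA: "pmap x \<in> A" if "x \<in> A" for x
    using pmap_p_span[OF char_ge_3 comm] that by (simp add: A_def)
  have AA: "bracket x y = 0" if "x \<in> A" "y \<in> A" for x y
    using p_span_abelian[OF comm] that by (simp add: A_def)
  have eh: "e \<in> A" "h \<in> A"
    by (simp_all add: A_def S_def p_span_base)
  define B where "B = p_span (pmap ` S)"
  have B: "subspace B"
    by (simp add: B_def subspace_p_span)
  have BA: "B \<subseteq> A"
    by (simp add: A_def B_def p_span_image_subset)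
  have AB: "pmap x \<in> B" if "x \<in> A" for x
    using pmap_p_span_image[OF char_ge_3 comm] that by (simp add: A_def B_def)
  have B0: "B \<subseteq> zero_weight"
    unfolding B_def using e h
    by (intro p_span_subset subspace_weight) (auto simp: S_def intro: pmap_weight)
  interpret A: semilinear_endomorphism scale Basis pmap A "CHAR('k)"
    using A pA AA by (intro semilinear_pmap pmap_add_commuting char_ge_3)
  have zA: "bracket z x = 0" if "x \<in> A" for x
    using that e h unfolding A_def
    by (intro p_span_bracket_zero[of S z x]) (auto simp: S_def weight_commutes)
  have e_notin: "e \<notin> pmap ` A"
    using AB B0 weight_zero[OF e(1) _ e(3,4)] e(2) by blast
  have decomp: "\<exists>c y. y \<in> A \<and> x = scale c e + pmap y" if "x \<in> A" for x
    using A.span_insert_phi_image[of z e x] null_line zA e_notin eh that by metis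
  obtain n where n: "\<And>x. x \<in> B \<Longrightarrow> (pmap ^^ n) x \<in> T"
  proof (rule funpow_pmap_mem_max_torus[OF T_max B])
    show "pmap x \<in> B" if "x \<in> B" for x
      using AB BA that by blast
    show "B \<subseteq> centralizer T"
      using B0 zero_weight_subset by (rule subset_trans)
    show "bracket x y = 0" if "x \<in> B" "y \<in> B" for x y
      using AA BA that by blast
  qed blast
  \<comment> \<open>Descending induction on \<open>m\<close>: at \<open>m = n\<close> the element
    lies in \<open>T\<close>, and each step down splits off a multiple of a p-th power of
    \<open>e\<close>. The exponent \<open>Suc m\<close> keeps \<open>e\<close> itself from
    occurring.\<close>
  have kill: "bracket f ((pmap ^^ Suc m) y) = 0" if "m \<le> n" "y \<in> A" for m y
    using that
  proof (induction m arbitrary: y rule: inc_induct)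
    case base
    define u where "u = (pmap ^^ Suc n) y"
    have u: "u \<in> T"
      using n[OF AB[OF base]] by (simp add: u_def funpow_swap1)
    have "bracket e u = 0"
      unfolding u_def using AA[OF eh(1) base] by (rule bracket_funpow_pmap_right_eq_zero)
    then have "\<gamma> u = 0"
      using e u by (auto simp: weight_def bracket_commute_zero[of e])
    then have "bracket u f = 0"
      using f(1,2) u by (auto simp: weight_def)
    then show ?case
      unfolding u_def by (rule bracket_commute_zero[THEN iffD1])
  next
    case (step m)
    obtain c w where w: "w \<in> A" "y = scale c e + pmap w"
      using decomp step.prems by blast
    have "bracket f (pmap e) = 0"
      using f(3) bracket_commute_zero by blast
    then have 1: "bracket f ((pmap ^^ Suc m) e) = 0"
      using bracket_funpow_pmap_right_eq_zero[of f "pmap e" m] by (simp add: funpow_swap1)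
    have 2: "bracket f ((pmap ^^ Suc m) (pmap w)) = 0"
      using step.IH[OF w(1)] by (simp add: funpow_swap1)
    have "(pmap ^^ Suc m) y = (pmap ^^ Suc m) (scale c e) + (pmap ^^ Suc m) (pmap w)"
      unfolding w(2) using AA eh w pA A by (intro funpow_pmap_add_commuting) (simp add: subspace_scale)
    then show ?case
      using 1 2 by (simp only: funpow_pmap_scale bracket_simps) simp
  qed
  obtain c y where y: "y \<in> A" "h = scale c e + pmap y"
    using decomp eh by blast
  \<comment> \<open>Comparing weights removes the multiple of \<open>e\<close>, so \<open>h\<close>
    itself is a p-th power in \<open>A\<close>.\<close>
  have "h - pmap y \<in> zero_weight"
    using h(1) B0 AB[OF y(1)] by (intro subspace_diff[OF subspace_weight]) auto
  then have "scale c e \<in> zero_weight"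
    using y(2) by simp
  then have "scale c e = 0"
    using subspace_scale[OF subspace_weight e(1)] e(3,4) by (intro weight_zero)
  then have "h = pmap y"
    unfolding y(2) by simp
  then show ?thesis
    using kill[of 0 y] y(1) by simp
qed

text \<open>Some iterated p-th power u of \<open>pmap e\<close> lies in \<open>T\<close>. It
  commutes with \<open>e\<close>, so \<gamma> and hence \<delta> vanish on it and u kills
  \<open>v\<close>. But ad u is a power of ad \<open>pmap e\<close>, and the last nonzero vector
  among the iterates on \<open>v\<close> is the one wanted.\<close>

lemma ex_weight_vector_commuting_with_pmap:
  assumes e: "e \<in> weight \<gamma>" "e \<noteq> 0"
    and v: "v \<in> weight \<delta>" "v \<noteq> 0" "\<And>s. s \<in> T \<Longrightarrow> \<gamma> s = 0 \<Longrightarrow> \<delta> s = 0"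
  obtains w where "w \<in> weight \<delta>" "w \<noteq> 0" "bracket (pmap e) w = 0"
proof -
  obtain n where n: "(pmap ^^ n) (pmap e) \<in> T"
    using ex_funpow_pmap_mem_max_torus[OF T_max] pmap_weight[OF e(1)] zero_weight_subset by blast
  define u where "u = (pmap ^^ n) (pmap e)"
  have "bracket e u = 0"
    unfolding u_def by (intro bracket_funpow_pmap_right_eq_zero bracket_pmap_right_eq_zero bracket_self)
  then have "\<gamma> u = 0"
    using e n by (auto simp: weight_def bracket_commute_zero[of e] u_def[symmetric])
  then have "bracket u v = 0"
    using v n by (auto simp: weight_def u_def[symmetric])
  then have "(bracket (pmap e) ^^ (CHAR('k) ^ n)) v = 0"
    by (simp add: u_def bracket_funpow_pmap)
  then obtain m where m: "(bracket (pmap e) ^^ m) v \<noteq> 0"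
    "bracket (pmap e) ((bracket (pmap e) ^^ m) v) = 0"
    using v(2) by (rule funpow_last_nonzero)
  have "(bracket (pmap e) ^^ m) v \<in> weight \<delta>"
    using v(1) by (rule funpow_mem_invariant) (rule weight_bracket_eq[OF pmap_weight[OF e(1)]], auto)
  then show ?thesis
    using that m by blast
qed

section \<open>Exclusion of sl_2\<close>

text \<open>If a vector x commutes with an abelian p-subalgebra A of weight zero and x^[p] is a p-th
  power from A, then x differs from an element of A by a multiple of \<open>z\<close>, so it has
  weight zero. For a suitable A this shows that neither e^[p] nor f^[p] is such a p-th power. As
  p-th powers from A have codimension at most one in A, some conjugate of \<open>e\<close> must have
  its p-th power among them, and that conjugate has nonzero-weight components.\<close>

lemma no_sl2:
  assumes e: "e \<in> weight \<gamma>" "s \<in> T" "\<gamma> s \<noteq> 0"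
    and f: "f \<in> weight \<delta>" "s' \<in> T" "\<delta> s' \<noteq> 0"
    and h0: "bracket e f \<in> zero_weight" "bracket e f \<noteq> 0"
    and he0: "bracket (bracket e f) e = scale 2 e" and hf0: "bracket (bracket e f) f = scale (- 2) f"
  shows False
proof -
  note sym = bracket_commute_zero[THEN iffD1]
  define p where "p = CHAR('k)"
  have p3: "p \<ge> 3"
    using char_ge_3 by (simp add: p_def)
  have odd: "odd p"
    unfolding p_def using prime_char char_ge_3 prime_odd_nat by force
  define h where "h = bracket e f"
  note h = h0[folded h_def] and he = he0[folded h_def] and hf = hf0[folded h_def]
  have ef: "bracket e f = h" and fe: "bracket f e = - h"
    using bracket_skew[of f e] by (simp_all add: h_def)
  have eh: "bracket e h = scale (- 2) e" and fh: "bracket f h = scale 2 f"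
    using bracket_skew[of e h] bracket_skew[of f h] by (simp_all add: he hf)
  note table = ef fe eh fh he hf bracket_self
  have e_nonzero: "e \<noteq> 0" and f_nonzero: "f \<noteq> 0"
    using h ef by (auto simp: bracket_simps)
  have two: "(2 :: 'k) ^ p = 2" "(- 2 :: 'k) ^ p = - 2"
    using of_nat_power_char[of 2] odd by (simp_all add: p_def power_minus_odd)

  \<comment> \<open>These measure the deviation from the standard p-map of sl_2, where e^[p] = f^[p]
    = 0 and h^[p] = h. They commute with \<open>e\<close>, \<open>f\<close>, \<open>h\<close> and
    with each other.\<close>
  define E F H where "E = pmap e" and "F = pmap f" and "H = pmap h - h"
  have pmap_kills: "bracket (pmap x) y = 0" if "bracket x (bracket x (bracket x y)) = 0" for x y
  proof -
    have "(bracket x ^^ 3) y = 0"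
      using that by (simp add: numeral_3_eq_3)
    then show ?thesis
      using char_ge_3 by (simp add: bracket_pmap funpow_bracket_eq_zero[of 3])
  qed
  have E: "bracket e E = 0" "bracket f E = 0"
    unfolding E_def by (rule sym, rule pmap_kills, simp add: table bracket_simps)+
  have F: "bracket e F = 0" "bracket f F = 0"
    unfolding F_def by (rule sym, rule pmap_kills, simp add: table bracket_simps)+
  have "bracket (pmap h) e = scale 2 e" "bracket (pmap h) f = scale (- 2) f"
    using funpow_bracket_weight[OF he, of p] funpow_bracket_weight[OF hf, of p]
    by (simp_all add: bracket_pmap two flip: p_def)
  then have "bracket H e = 0" "bracket H f = 0"
    by (simp_all add: H_def bracket_diff_left he hf)
  then have H: "bracket e H = 0" "bracket f H = 0"
    by (auto intro: sym)
  define S where "S = {E, F, H}"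
  have S: "bracket e x = 0" "bracket f x = 0" "bracket h x = 0" if "x \<in> S" for x
  proof -
    show *: "bracket e x = 0" "bracket f x = 0"
      using that E F H by (auto simp: S_def)
    have "bracket x h = 0"
      using *[THEN sym] by (simp add: h_def bracket_leibniz[of x] bracket_simps)
    then show "bracket h x = 0"
      by (rule sym)
  qed
  have "bracket E x = 0" "bracket F x = 0" if "x \<in> S" for x
    using S[OF that] by (auto simp: E_def F_def intro: bracket_pmap_eq_zero)
  then have comm: "bracket x y = 0" if "x \<in> S" "y \<in> S" for x y
    using that sym by (auto simp: S_def bracket_self)
  define A where "A = p_span S"
  have A: "subspace A"
    by (simp add: A_def subspace_p_span)
  have pA: "pmap x \<in> A" if "x \<in> A" for x
    using pmap_p_span[OF char_ge_3 comm] that by (simp add: A_def)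
  have AA: "bracket x y = 0" if "x \<in> A" "y \<in> A" for x y
    using p_span_abelian[OF comm] that by (simp add: A_def)
  have SA: "E \<in> A" "F \<in> A" "H \<in> A"
    by (simp_all add: A_def S_def p_span_base)
  have E0: "E \<in> zero_weight" "F \<in> zero_weight" "H \<in> zero_weight"
    using e f h by (auto simp: E_def F_def H_def intro!: subspace_diff[OF subspace_weight] pmap_weight)
  then have A0: "A \<subseteq> zero_weight"
    unfolding A_def by (intro p_span_subset subspace_weight) (auto simp: S_def intro: pmap_weight)
  have efhA: "bracket e x = 0" "bracket f x = 0" "bracket h x = 0" if "x \<in> A" for x
    using that p_span_bracket_zero[of S] S unfolding A_def by blast+
  interpret A: semilinear_endomorphism scale Basis pmap A "CHAR('k)"
    using A pA AA by (intro semilinear_pmap pmap_add_commuting char_ge_3)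
  have zA: "bracket z x = 0" if "x \<in> A" for x
    using that A0 weight_commutes by blast

  have no_lift: "x \<in> zero_weight"
    if "bracket z x = 0" "pmap x \<in> pmap ` A" "\<And>q. q \<in> A \<Longrightarrow> bracket x q = 0" for x
  proof -
    obtain q where q: "q \<in> A" "pmap x = pmap q"
      using \<open>pmap x \<in> pmap ` A\<close> by auto
    then have "pmap (x - q) = 0"
      using \<open>\<And>q. q \<in> A \<Longrightarrow> bracket x q = 0\<close> by (simp add: pmap_diff_commuting)
    moreover have "bracket z (x - q) = 0"
      using \<open>bracket z x = 0\<close> zA[OF q(1)] by (simp add: bracket_simps)
    ultimately have "x - q \<in> zero_weight"
      using null_line span_z_subset by blast
    then have "x - q + q \<in> zero_weight"
      using q(1) A0 by (intro subspace_add[OF subspace_weight]) auto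
    then show ?thesis
      by simp
  qed
  have "E \<notin> pmap ` A"
    using no_lift[of e] weight_zero[OF e(1) _ e(2,3)] e_nonzero efhA weight_commutes[OF e(1)]
    by (auto simp: E_def)
  then have decomp: "\<exists>c y. y \<in> A \<and> x = scale c E + pmap y" if "x \<in> A" for x
    using A.span_insert_phi_image[of z E x] null_line zA SA(1) that by metis
  have F_notin: "F \<notin> pmap ` A"
    using no_lift[of f] weight_zero[OF f(1) _ f(2,3)] f_nonzero efhA weight_commutes[OF f(1)]
    by (auto simp: F_def)
  obtain c1 y1 where y1: "y1 \<in> A" "H = scale c1 E + pmap y1"
    using decomp SA by blast
  obtain c2 y2 where y2: "y2 \<in> A" "F = scale c2 E + pmap y2"
    using decomp SA by blast
  have c2: "c2 \<noteq> 0"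
    using y2 F_notin by auto
  \<comment> \<open>Modulo p-th powers from \<open>A\<close>, the combination
    \<open>E + m H - m^2 F\<close> is this polynomial in \<open>m\<close> times \<open>E\<close>. It
    is nonconstant because \<open>c2\<close> is nonzero.\<close>
  have "\<exists>m. poly [:1, c1, - c2:] m = 0"
    by (rule alg_closed_imp_poly_has_root) (simp add: c2)
  then obtain m where m: "1 + c1 * m - c2 * m\<^sup>2 = 0"
    by (auto simp: algebra_simps power2_eq_square)
  \<comment> \<open>The p-map raises coefficients to the power p, so the parameter \<open>a\<close>
    of the conjugate is a p-th root of \<open>m\<close>.\<close>
  obtain a where a: "a ^ p = m"
    using nth_root_exists[of p m] p3 by auto
  define P where "P = E + scale m H - scale (m\<^sup>2) F"
  have "P = scale (1 + c1 * m - c2 * m\<^sup>2) E + (scale m (pmap y1) - scale (m\<^sup>2) (pmap y2))"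
    unfolding P_def y1(2) y2(2)
    by (simp add: scale_right_distrib scale_left_distrib scale_left_diff_distrib mult.commute)
  then have "P = scale m (pmap y1) - scale (m\<^sup>2) (pmap y2)"
    by (simp add: m)
  moreover have "subspace (pmap ` A)"
    by (rule A.subspace_phi_image[OF A order_refl])
  ultimately have P_image: "P \<in> pmap ` A"
    using y1 y2 by (auto intro!: subspace_diff subspace_scale)
  have PA: "P \<in> A"
    unfolding P_def using SA A by (intro subspace_diff subspace_add subspace_scale)

  text \<open>The nilpotent elements \<open>e + a h - a\<^sup>2 f\<close> are the conjugates of \<open>e\<close> under \<open>exp (- a ad f)\<close>.\<close>
  define x where "x = e + scale a h - scale (a\<^sup>2) f"
  have xe: "bracket x e = scale (2 * a) e + scale (a\<^sup>2) h"
    by (simp add: x_def bracket_simps table mult.commute)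
  have xh: "bracket x h = scale (- 2) e - scale (2 * a\<^sup>2) f"
    by (simp add: x_def bracket_simps table mult.commute)
  have xf: "bracket x f = h - scale (2 * a) f"
    by (simp add: x_def bracket_simps table mult.commute)
  have quad: "scale (b * (c * 4)) u = scale (b * (c * 2)) u + scale (b * (c * 2)) u" for b c u
    by (simp flip: scale_left_distrib distrib_left)
  have xxf: "bracket x (bracket x f) = scale (- 2) x"
    by (simp add: xf bracket_simps xh)
       (simp add: x_def algebra_simps power2_eq_square scale_left_distrib mult_2 quad)
  have xxe: "bracket x (bracket x e) = scale (2 * a\<^sup>2) x"
    by (simp add: xe bracket_simps xh)
       (simp add: x_def algebra_simps power2_eq_square scale_left_distrib mult_2 quad)
  have px: "bracket (pmap x) e = 0" "bracket (pmap x) f = 0"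
    by (rule pmap_kills, simp add: xxe xxf bracket_simps)+

  define V where "V = span {e, f, h}"
  have V: "subspace V" "e \<in> V" "f \<in> V" "h \<in> V"
    by (auto simp: V_def intro: span_base)
  have V_closed: "bracket u v \<in> V" if "u \<in> V" "v \<in> V" for u v
    using that unfolding V_def
  proof (rule span_bracket_closed[rotated])
    show "bracket a b \<in> span {e, f, h}" if "a \<in> {e, f, h}" "b \<in> {e, f, h}" for a b
      using that V by (auto simp: table span_zero V_def intro!: span_neg span_scale)
  qed
  have "scale a h \<in> V" "scale (- (a\<^sup>2)) f \<in> V" "e + scale a h \<in> V"
    using V by (auto intro!: subspace_add subspace_scale subspace_neg)
  note inV = this
  obtain v1 where v1: "v1 \<in> V" "pmap (e + scale a h) = pmap e + pmap (scale a h) + v1"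
    using pmap_add_mod[OF V(1,2) inV(1) V_closed] by blast
  obtain v2 where v2: "v2 \<in> V"
    "pmap (e + scale a h + scale (- (a\<^sup>2)) f) = pmap (e + scale a h) + pmap (scale (- (a\<^sup>2)) f) + v2"
    using pmap_add_mod[OF V(1) inV(3,2) V_closed] by blast
  \<comment> \<open>This is the difference of \<open>pmap x\<close> and \<open>P\<close>: Jacobson's
    terms contribute \<open>v1\<close> and \<open>v2\<close>, and \<open>h\<close> comes from
    \<open>pmap h = H + h\<close>.\<close>
  define y where "y = scale m h + v1 + v2"
  have "(a\<^sup>2) ^ p = m\<^sup>2"
    using a by (metis power_mult mult.commute)
  then have "pmap x = P + y"
    using v1(2) v2(2) a
    by (simp add: x_def P_def y_def pmap_scale pmap_minus E_def F_def H_def algebra_simps flip: p_def)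
  \<comment> \<open>No Jacobson term is computed: \<open>y\<close> lies in the span of
    \<open>e\<close>, \<open>f\<close>, \<open>h\<close> and commutes with \<open>e\<close> and
    \<open>f\<close>, because \<open>pmap x\<close> and \<open>P\<close> both do, and this leaves
    only zero.\<close>
  moreover have "y = 0"
  proof -
    have "y \<in> V"
      unfolding y_def using v1 v2 V by (intro subspace_add subspace_scale)
    then obtain k1 k2 k3 where "y - scale k1 e - scale k2 f - scale k3 h = 0"
      unfolding V_def by (auto simp: span_breakdown_eq)
    then have y: "y = scale k1 e + scale k2 f + scale k3 h"
      by (simp add: algebra_simps)
    have "bracket e P = 0" "bracket f P = 0"
      using efhA PA by blast+
    then have ey: "bracket e y = 0" and fy: "bracket f y = 0"
      using px[THEN sym] \<open>pmap x = P + y\<close> by (simp_all add: bracket_simps)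
    have "scale k2 h + scale (k3 * (- 2)) e = 0"
      using ey by (simp add: y bracket_simps table)
    then have k: "scale k2 h = scale (k3 * 2) e"
      by (simp add: add_eq_0_iff)
    have "scale k2 h \<in> zero_weight"
      using h(1) by (rule subspace_scale[OF subspace_weight])
    then have "scale (k3 * 2) e = 0"
      unfolding k using subspace_scale[OF subspace_weight e(1)] e(2,3) by (intro weight_zero)
    then have k3: "k3 = 0"
      using e_nonzero two_nonzero by simp
    then have k2: "k2 = 0"
      using k h by simp
    have "scale k1 h = 0"
      using fy by (simp add: y k2 k3 bracket_simps table)
    then show ?thesis
      using h by (simp add: y k2 k3)
  qed
  ultimately have "pmap x \<in> pmap ` A"
    using P_image by simp
  moreover have "bracket z x = 0"
    using weight_commutes[OF e(1)] weight_commutes[OF f(1)] weight_commutes[OF h(1)]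
    by (simp add: x_def bracket_simps)
  moreover have "bracket x q = 0" if "q \<in> A" for q
    using efhA[OF that] by (simp add: x_def bracket_simps)
  ultimately have "x \<in> zero_weight"
    using no_lift by blast
  then have "x - scale a h \<in> zero_weight"
    using h(1) by (intro subspace_diff[OF subspace_weight] subspace_scale[OF subspace_weight])
  then have "e - scale (a\<^sup>2) f \<in> zero_weight"
    by (simp add: x_def)
  then obtain c where "e = scale c f"
    using weight_proportional[OF f(1) e] by blast
  then have "h = 0"
    unfolding h_def by (simp add: bracket_simps)
  then show False
    using h by simp
qed

section \<open>Opposite weights and root strings\<close>

lemma commuting_weight_vectors:
  assumes e: "e \<in> weight \<gamma>" "e \<noteq> 0" "s \<in> T" "\<gamma> s \<noteq> 0"
    and f: "f \<in> weight \<delta>" "s' \<in> T" "\<delta> s' \<noteq> 0" and "bracket e f = 0"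
  shows "\<exists>c. f = scale c e"
  using heisenberg_proportional[OF e f] assms(8)
  by (simp add: bracket_simps subspace_0[OF subspace_weight])

lemma weight_eqD: "x \<in> weight \<gamma> \<Longrightarrow> x \<in> weight \<delta> \<Longrightarrow> x \<noteq> 0 \<Longrightarrow> s \<in> T \<Longrightarrow> \<gamma> s = \<delta> s"
  by (auto simp: weight_def)

lemma bracket_weight_nonzero:
  assumes e: "e \<in> weight \<gamma>" "e \<noteq> 0" "s \<in> T" "\<gamma> s \<noteq> 0"
    and f: "f \<in> weight \<delta>" "f \<noteq> 0" "s' \<in> T" "\<delta> s' \<noteq> 0"
    and "t \<in> T" "\<gamma> t \<noteq> \<delta> t"
  shows "bracket e f \<noteq> 0"
proof
  assume "bracket e f = 0"
  then obtain c where "f = scale c e"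
    using commuting_weight_vectors[OF e f(1,3,4)] by blast
  then have "f \<in> weight \<gamma>"
    using e(1) by (simp add: subspace_scale subspace_weight)
  then show False
    using weight_eqD[OF _ f(1,2) assms(9)] assms(10) by blast
qed

text \<open>Put h = [e, f]. It commutes with \<open>e\<close> by hypothesis, hence with
  \<open>f\<close> by \<open>zero_weight_commutes\<close>, and the Heisenberg case makes
  \<open>f\<close> a multiple of \<open>e\<close>. Then \<alpha> = -\<alpha> on \<open>T\<close>,
  impossible in odd characteristic.\<close>

lemma no_double_zero:
  assumes e: "e \<in> weight \<alpha>" "e \<noteq> 0" "s \<in> T" "\<alpha> s \<noteq> 0"
    and f: "f \<in> weight (\<lambda>s. - \<alpha> s)" and "bracket e (bracket e f) = 0"
  shows "f = 0"
proof (rule ccontr)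
  assume "f \<noteq> 0"
  have h: "bracket e f \<in> zero_weight"
    using e(1) f by (rule weight_bracket_eq) simp
  have "(bracket e ^^ 2) f = 0"
    using assms(6) by (simp add: numeral_2_eq_2)
  then have "bracket (pmap e) f = 0"
    using char_ge_3 by (simp add: bracket_pmap funpow_bracket_eq_zero[of 2])
  then have "bracket f (bracket e f) = 0"
    using h assms(6) by (intro zero_weight_commutes[OF e f]) simp_all
  then obtain c where "f = scale c e"
    using heisenberg_proportional[OF e f e(3) _ h assms(6)] e(4) by auto
  then have "f \<in> weight \<alpha>"
    using e(1) by (simp add: subspace_scale subspace_weight)
  then have "\<alpha> s = - \<alpha> s"
    using weight_eqD[OF _ f \<open>f \<noteq> 0\<close> e(3)] by blast
  then have "2 * \<alpha> s = 0"
    unfolding mult_2 by (rule eq_neg_iff_add_eq_0[THEN iffD1])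
  then show False
    using two_nonzero e(4) by simp
qed

lemma no_opposite:
  assumes e: "e \<in> weight \<alpha>" "e \<noteq> 0" "s \<in> T" "\<alpha> s \<noteq> 0"
    and f: "f \<in> weight (\<lambda>s. - \<alpha> s)" and eef: "bracket e (bracket e f) = scale c e"
  shows "f = 0"
proof (cases "c = 0")
  case True
  then show ?thesis
    using no_double_zero[OF e f] eef by simp
next
  case False
  define h where "h = bracket e f"
  have h: "h \<in> zero_weight"
    unfolding h_def using e(1) f by (rule weight_bracket_eq) simp
  have eh: "bracket e h = scale c e"
    using eef by (simp add: h_def)
  then have "h \<noteq> 0"
    using False e(2) by (auto simp: bracket_simps)
  \<comment> \<open>The defect [h, f] - c f is killed by ad \<open>e\<close> and has weight
    -\<alpha>, so the case of a vanishing double bracket shows that it is zero.\<close>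
  have "bracket e (bracket h f) = scale c h"
    using bracket_leibniz[of e h f] by (simp add: eh bracket_simps flip: h_def)
  then have "bracket e (bracket e (bracket h f - scale c f)) = 0"
    by (simp add: bracket_simps eh flip: h_def)
  moreover have "bracket h f \<in> weight (\<lambda>s. - \<alpha> s)"
    using h f by (rule weight_bracket_eq) simp
  then have "bracket h f - scale c f \<in> weight (\<lambda>s. - \<alpha> s)"
    using f by (intro subspace_diff subspace_scale subspace_weight)
  ultimately have "bracket h f - scale c f = 0"
    using no_double_zero[OF e] by blast
  then have hf: "bracket h f = scale c f"
    by simp
  have he: "bracket h e = scale (- c) e"
    using eh bracket_skew[of h e] by simp
  \<comment> \<open>Rescaling \<open>f\<close> by \<open>b\<close> turns [h, e] = -c e into the
    relation [h, e] = 2e of an sl_2-triple.\<close>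
  define b where "b = - (2 / c)"
  have b: "b \<noteq> 0" "b * c = - 2"
    using False two_nonzero by (simp_all add: b_def)
  have bf: "scale b f \<in> weight (\<lambda>s. - \<alpha> s)"
    using f by (rule subspace_scale[OF subspace_weight])
  have ebf: "bracket e (scale b f) = scale b h"
    by (simp add: bracket_simps h_def)
  have False
  proof (rule no_sl2[OF e(1,3,4) bf e(3)], unfold ebf)
    show "- \<alpha> s \<noteq> 0"
      using e(4) by simp
    show "scale b h \<in> zero_weight"
      using h by (rule subspace_scale[OF subspace_weight])
    show "scale b h \<noteq> 0"
      using b \<open>h \<noteq> 0\<close> by simp
    show "bracket (scale b h) e = scale 2 e"
      using b by (simp add: bracket_simps he)
    show "bracket (scale b h) (scale b f) = scale (- 2) (scale b f)"
      using b by (simp add: bracket_simps hf)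
  qed
  then show ?thesis ..
qed

lemma no_second_root_on_line:
  assumes e: "e \<in> weight \<alpha>" "e \<noteq> 0" "s \<in> T" "\<alpha> s \<noteq> 0"
    and j: "2 \<le> j" "j < CHAR('k)" and v: "v \<in> weight (\<lambda>s. of_nat j * \<alpha> s)" "v \<noteq> 0"
  shows False
proof -
  define p where "p = CHAR('k)"
  have p3: "p \<ge> 3"
    using char_ge_3 by (simp add: p_def)
  \<comment> \<open>Indexing by natural numbers lets a string pass from p - 1 through p, of weight
    zero, to p + 1, of weight \<alpha>.\<close>
  define W where "W i = weight (\<lambda>s. of_nat i * \<alpha> s)" for i
  have of_nat_p: "of_nat (p + i) = (of_nat i :: 'k)" for i
    by (simp add: p_def)
  have W_mod: "W (p + i) = W i" for i
    unfolding W_def of_nat_p ..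
  have W1: "W 1 = weight \<alpha>" and W_minus: "W (p - 1) = weight (\<lambda>s. - \<alpha> s)"
    using p3 by (simp_all add: W_def of_nat_diff p_def)
  have W_Suc: "bracket e x \<in> W (Suc i)" if "x \<in> W i" for x i
    unfolding W_def using e(1) that[unfolded W_def]
    by (rule weight_bracket_eq) (simp add: distrib_right)
  have nonzero: "bracket e x \<noteq> 0" if "x \<in> W i" "x \<noteq> 0" "2 \<le> i" "i < p" for x i
  proof (rule bracket_weight_nonzero[OF e that(1)[unfolded W_def] that(2) e(3) _ e(3)])
    show "of_nat i * \<alpha> s \<noteq> 0"
      using of_nat_eq_zero_imp[of i] that e(4) by (auto simp: p_def)
    have "of_nat (i - 1) \<noteq> (0 :: 'k)"
      using of_nat_eq_zero_imp[of "i - 1"] that unfolding p_def by linarith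
    then show "\<alpha> s \<noteq> of_nat i * \<alpha> s"
      using that e(4) by (simp add: of_nat_diff)
  qed
  have chain: "(bracket e ^^ m) x \<in> W (i + m) \<and> (bracket e ^^ m) x \<noteq> 0"
    if "x \<in> W i" "x \<noteq> 0" "2 \<le> i" "i + m \<le> p" for x i m
    using that(4)
  proof (induction m)
    case 0
    show ?case using that by simp
  next
    case (Suc m)
    then show ?case
      using W_Suc[of "(bracket e ^^ m) x" "i + m"] nonzero[of "(bracket e ^^ m) x" "i + m"] that by simp
  qed
  \<comment> \<open>The choice means that (ad e)^p kills \<open>w\<close>, so the string starting
    there cannot return to weight j\<alpha>.\<close>
  obtain w where w: "w \<in> W j" "w \<noteq> 0" "bracket (pmap e) w = 0"
    using ex_weight_vector_commuting_with_pmap[OF e(1,2) v] by (auto simp: W_def)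
  define f where "f = (bracket e ^^ (p - 1 - j)) w"
  have f: "f \<in> W (p - 1)" "f \<noteq> 0"
    using chain[OF w(1,2) j(1), of "p - 1 - j"] j by (auto simp: f_def p_def)
  define g where "g = bracket e (bracket e f)"
  have "g \<in> W (Suc (Suc (p - 1)))"
    unfolding g_def using f by (intro W_Suc)
  then have g1: "g \<in> W 1"
    using W_mod[of 1] p3 by simp
  have "bracket e g = 0"
  proof (rule ccontr)
    assume "bracket e g \<noteq> 0"
    moreover have "bracket e g \<in> W 2"
      using W_Suc[OF g1] by (simp add: numeral_2_eq_2)
    ultimately have "(bracket e ^^ (j - 2)) (bracket e g) \<noteq> 0"
      using chain[of "bracket e g" 2 "j - 2"] j by (simp add: p_def)
    moreover have "bracket e g = (bracket e ^^ 3) f"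
      by (simp add: g_def numeral_3_eq_3)
    \<comment> \<open>One full round: from j up to p - 1, three steps from there to 2, and on to
      j.\<close>
    moreover have "j - 2 + (3 + (p - 1 - j)) = p"
      using j by (simp add: p_def)
    ultimately have "(bracket e ^^ p) w \<noteq> 0"
      by (metis f_def funpow_add comp_apply)
    then show False
      using w(3) by (simp add: bracket_pmap p_def)
  qed
  then obtain c where "g = scale c e"
    using commuting_weight_vectors[OF e, of g \<alpha> s] g1 W1 e(3,4) by auto
  then have "f = 0"
    using no_opposite[OF e] f(1) W_minus by (auto simp: g_def)
  then show False
    using f by simp
qed

text \<open>If \<beta> is not a multiple of \<alpha> over the prime field, climbing along \<beta>
  from 2\<alpha> + \<beta> reaches 2\<alpha> + p\<beta> = 2\<alpha>, a second root on the line of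
  \<alpha>. No bracket on the way vanishes, since the weights 2\<alpha> + a\<beta> are neither 0 nor
  \<beta>.\<close>

lemma no_two_roots:
  assumes e: "e \<in> weight \<alpha>" "e \<noteq> 0" "s \<in> T" "\<alpha> s \<noteq> 0"
    and v: "v \<in> weight \<beta>" "v \<noteq> 0" "s' \<in> T" "\<beta> s' \<noteq> 0"
    and distinct: "t \<in> T" "\<alpha> t \<noteq> \<beta> t"
  shows False
proof (cases "\<exists>a\<in>prime_field. \<forall>s\<in>T. \<beta> s = a * \<alpha> s")
  case True
  then obtain n where n: "\<And>s. s \<in> T \<Longrightarrow> \<beta> s = of_nat n * \<alpha> s"
    by (auto simp: prime_field_def)
  define j where "j = n mod CHAR('k)"
  have "(of_nat n :: 'k) = of_nat (CHAR('k) * (n div CHAR('k)) + j)"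
    by (simp only: j_def mult_div_mod_eq)
  then have j: "of_nat j = (of_nat n :: 'k)"
    by simp
  have nj: "\<beta> s = of_nat j * \<alpha> s" if "s \<in> T" for s
    using n[OF that] by (simp only: j)
  have "j \<noteq> 0"
    using nj[OF v(3)] v(4) by (intro notI) simp
  moreover have "j \<noteq> 1"
    using nj[OF distinct(1)] distinct(2) by (intro notI) simp
  moreover have "j < CHAR('k)"
    by (simp add: j_def char_pos)
  moreover have "v \<in> weight (\<lambda>s. of_nat j * \<alpha> s)"
    using v(1) nj weight_cong[of \<beta> "\<lambda>s. of_nat j * \<alpha> s"] by blast
  ultimately show ?thesis
    using no_second_root_on_line[OF e, of j v] v(2) by auto
next
  case False
  then have indep: "\<exists>t\<in>T. \<beta> t \<noteq> a * \<alpha> t" if "a \<in> prime_field" for a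
    using that by blast
  have indep': "\<exists>t\<in>T. \<alpha> t \<noteq> a * \<beta> t" if "a \<in> prime_field" for a
  proof (rule ccontr)
    assume "\<not> ?thesis"
    then have *: "\<alpha> t = a * \<beta> t" if "t \<in> T" for t
      using that by blast
    then have "a \<noteq> 0"
      using e(3,4) by auto
    then have "\<beta> t = inverse a * \<alpha> t" if "t \<in> T" for t
      using *[OF that] by simp
    then show False
      using indep[OF prime_field_inverse[OF that]] by blast
  qed
  have ev: "bracket e v \<in> weight (\<lambda>s. \<alpha> s + \<beta> s)" "bracket e v \<noteq> 0"
    using weight_bracket[OF e(1) v(1)] bracket_weight_nonzero[OF e v distinct] by auto
  obtain t1 where t1: "t1 \<in> T" "\<alpha> t1 + \<beta> t1 \<noteq> 0"
    using indep[of "- 1"] prime_field_minus[OF prime_field_numeral(2)] by (auto simp: eq_neg_iff_add_eq_0 add.commute)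
  \<comment> \<open>Two brackets with \<open>e\<close> are taken because climbing from \<alpha> +
    \<beta> would only lead back to \<alpha>.\<close>
  define u where "u = bracket e (bracket e v)"
  have "bracket e (bracket e v) \<noteq> 0"
    using v(4) by (intro bracket_weight_nonzero[OF e ev t1 v(3)]) simp
  then have u: "u \<in> weight (\<lambda>s. 2 * \<alpha> s + of_nat 1 * \<beta> s)" "u \<noteq> 0"
    using weight_bracket_eq[OF e(1) ev(1), of "\<lambda>s. 2 * \<alpha> s + of_nat 1 * \<beta> s"] by (simp_all add: u_def)
  have indep2: "\<exists>t\<in>T. 2 * \<alpha> t + a * \<beta> t \<noteq> 0" if "a \<in> prime_field" for a
  proof -
    have "- (inverse 2 * a) \<in> prime_field"
      using that by (intro prime_field_minus prime_field_mult prime_field_inverse prime_field_numeral)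
    then obtain t where t: "t \<in> T" "\<alpha> t \<noteq> - (inverse 2 * a) * \<beta> t"
      using indep' by blast
    have "2 * \<alpha> t + a * \<beta> t \<noteq> 0"
    proof
      assume "2 * \<alpha> t + a * \<beta> t = 0"
      then have "2 * \<alpha> t = - (a * \<beta> t)"
        by (simp add: eq_neg_iff_add_eq_0)
      then have "inverse 2 * (2 * \<alpha> t) = inverse 2 * - (a * \<beta> t)"
        by simp
      then show False
        using t(2) two_nonzero by (simp add: mult.assoc[symmetric])
    qed
    then show ?thesis
      using t(1) by blast
  qed
  have chain: "(bracket v ^^ m) u \<in> weight (\<lambda>s. 2 * \<alpha> s + of_nat (Suc m) * \<beta> s) \<and> (bracket v ^^ m) u \<noteq> 0" for m
  proof (induction m)
    case 0
    show ?case using u by simp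
  next
    case (Suc m)
    let ?a = "of_nat (Suc m) :: 'k"
    obtain t1 where t1: "t1 \<in> T" "2 * \<alpha> t1 + ?a * \<beta> t1 \<noteq> 0"
      using indep2[OF prime_field_of_nat] by blast
    obtain t2 where t2: "t2 \<in> T" "2 * \<alpha> t2 + (?a - 1) * \<beta> t2 \<noteq> 0"
      using indep2[OF prime_field_diff[OF prime_field_of_nat prime_field_numeral(2)]] by blast
    have "\<beta> t2 \<noteq> 2 * \<alpha> t2 + ?a * \<beta> t2"
      using t2(2) by (auto simp: algebra_simps)
    then have "bracket v ((bracket v ^^ m) u) \<noteq> 0"
      using bracket_weight_nonzero[OF v Suc[THEN conjunct1] Suc[THEN conjunct2] t1(1) _ t2(1)] t1(2)
      by blast
    moreover have "bracket v ((bracket v ^^ m) u) \<in> weight (\<lambda>s. 2 * \<alpha> s + of_nat (Suc (Suc m)) * \<beta> s)"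
      using v(1) Suc[THEN conjunct1] by (rule weight_bracket_eq) (simp add: algebra_simps)
    ultimately show ?case
      by simp
  qed
  have "of_nat (Suc (CHAR('k) - 1)) = (0 :: 'k)"
    using char_pos by simp
  then have "(bracket v ^^ (CHAR('k) - 1)) u \<in> weight (\<lambda>s. of_nat 2 * \<alpha> s)"
    "(bracket v ^^ (CHAR('k) - 1)) u \<noteq> 0"
    using chain[of "CHAR('k) - 1"] by auto
  then show ?thesis
    using char_ge_3 by (intro no_second_root_on_line[OF e]) auto
qed

end

section \<open>The null vector and the conclusion\<close>

context alg_closed_restricted_lie_algebra
begin

lemma generically_toral_if_p_rank_1:
  assumes "p_rank = 1" "num_roots \<ge> 2"
  shows generically_toral
proof -
  define T where "T = (SOME V. V \<in> Tor)"
  have T: "T \<in> Tor"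
    unfolding T_def using Tor_nonempty by (simp add: some_in_eq)
  then have torT: "torus T"
    by (simp add: Tor_def)
  then have T': "subspace T" "bij_betw pmap T T" "\<And>x y. x \<in> T \<Longrightarrow> y \<in> T \<Longrightarrow> bracket x y = 0"
    by (auto simp: torus_def p_subalgebra_def)
  have "card (roots T) \<ge> 2"
    using assms(2) by (simp add: num_roots_def T_def)
  then obtain R where "R \<subseteq> roots T" "card R = 2"
    by (meson obtain_subset_with_card_n)
  then obtain \<alpha> \<beta> where roots: "\<alpha> \<in> roots T" "\<beta> \<in> roots T" "\<alpha> \<noteq> \<beta>"
    by (auto simp: card_2_iff)
  have "centralizer T = T"
  proof (rule ccontr)
    assume "centralizer T \<noteq> T"
    moreover have "T \<subseteq> centralizer T"
      using T'(3) by (auto simp: centralizer_def)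
    ultimately obtain x where x: "x \<in> centralizer T" "x \<notin> T"
      by blast
    obtain n where n: "(pmap ^^ n) x \<in> T"
      using ex_funpow_pmap_mem_max_torus[OF T x(1)] .
    \<comment> \<open>On \<open>T\<close> the p-map is bijective, so subtracting an element of
      \<open>T\<close> from \<open>x\<close> makes it p-nilpotent; it stays nonzero because
      \<open>x\<close> is outside \<open>T\<close>.\<close>
    have "bij_betw (pmap ^^ n) T T"
      using T'(2) by (rule bij_betw_funpow)
    then obtain s where s: "s \<in> T" "(pmap ^^ n) s = (pmap ^^ n) x"
      using n by (metis bij_betw_imp_surj_on imageE)
    define y where "y = x - s"
    have y: "y \<in> centralizer T" "y \<noteq> 0"
      using x s T'(3) by (auto simp: y_def centralizer_def bracket_simps)
    have "bracket y s = 0"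
      using y s by (auto simp: centralizer_def bracket_commute_zero[of y s])
    then have "(pmap ^^ n) (y + s) = (pmap ^^ n) y + (pmap ^^ n) s"
      by (rule funpow_pmap_add_commuting)
    then have "(pmap ^^ n) y = 0"
      by (simp add: y_def s(2))
    then obtain m where m: "(pmap ^^ m) y \<noteq> 0" "pmap ((pmap ^^ m) y) = 0"
      using y(2) by (rule funpow_last_nonzero)
    define z where "z = (pmap ^^ m) y"
    have z: "z \<in> centralizer T" "z \<noteq> 0" "pmap z = 0"
      using m y(1) by (auto simp: z_def intro: funpow_mem_invariant pmap_centralizer)
    have null: "x \<in> span {z}" if x: "bracket z x = 0" "pmap x = 0" for x
    proof (rule ccontr)
      assume "x \<notin> span {z}"
      then have "dim (span {x, z}) = 2"
        using z(2) by (simp add: dim_insert)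
      moreover have "bracket u v = 0" if "u \<in> span {x, z}" "v \<in> span {x, z}" for u v
      proof (rule span_bracket_zero[OF _ that(2)])
        have zx: "bracket x z = 0"
          using x(1) by (simp add: bracket_commute_zero[of x])
        fix w assume w: "w \<in> {x, z}"
        then have "bracket w u = 0"
          using x(1) zx by (intro span_bracket_zero[OF _ that(1)]) (auto simp: bracket_self)
        then show "bracket u w = 0"
          by (rule bracket_commute_zero[THEN iffD1])
      qed
      moreover have "pmap u = 0" if "u \<in> span {x, z}" for u
      proof -
        obtain a where "u - scale a x \<in> span {z}"
          using \<open>u \<in> span {x, z}\<close> span_breakdown_eq[of u x "{z}"] by blast
        then obtain b where "u - scale a x = scale b z"
          by (auto simp: span_singleton)
        then have u: "u = scale a x + scale b z"
          by (simp add: algebra_simps)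
        have "bracket (scale a x) (scale b z) = 0"
          using x(1) bracket_commute_zero[of x z] by (simp add: bracket_simps)
        then show ?thesis
          using x(2) z(3) by (simp add: u pmap_add_commuting char_ge_3 pmap_scale)
      qed
      ultimately have "span {x, z} \<in> elementary_subalgebras 2"
        by (simp add: elementary_subalgebras_def)
      then have "2 \<le> p_rank"
        unfolding p_rank_def using p_rank_set(1) by (intro Max_ge) auto
      then show False
        using assms(1) by simp
    qed
    interpret line_nullcone scale bracket pmap Basis T z
      using T z(1) null by unfold_locales
    have weight_vector: "\<exists>w. w \<in> weight \<gamma> \<and> w \<noteq> 0" "\<exists>s\<in>T. \<gamma> s \<noteq> 0" if "\<gamma> \<in> roots T" for \<gamma>
    proof -
      have "root_space T \<gamma> \<noteq> {0}" "0 \<in> root_space T \<gamma>"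
        using that by (auto simp: roots_def root_space_def bracket_simps)
      then obtain v where v: "v \<in> root_space T \<gamma>" "v \<noteq> 0"
        by blast
      have inv: "bracket z w \<in> root_space T \<gamma>" if "w \<in> root_space T \<gamma>" for w
        using that z(1) by (auto simp: root_space_def bracket_leibniz[of _ z] centralizer_def bracket_simps)
      \<comment> \<open>As \<open>z\<close> is null, ad z is nilpotent, and it preserves the root
        spaces because \<open>z\<close> centralizes \<open>T\<close>. So each root space contains a
        nonzero vector commuting with \<open>z\<close>.\<close>
      have "(bracket z ^^ CHAR('k)) v = 0"
        using z(3) by (simp add: bracket_simps flip: bracket_pmap)
      then obtain m where "(bracket z ^^ m) v \<noteq> 0" "bracket z ((bracket z ^^ m) v) = 0"
        using v(2) by (rule funpow_last_nonzero)
      moreover have "(bracket z ^^ m) v \<in> root_space T \<gamma>"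
        using v(1) inv by (rule funpow_mem_invariant)
      ultimately show "\<exists>w. w \<in> weight \<gamma> \<and> w \<noteq> 0"
        by (auto simp: weight_def root_space_def)
      show "\<exists>s\<in>T. \<gamma> s \<noteq> 0"
      proof (rule ccontr)
        assume "\<not> ?thesis"
        then have "\<gamma> = (\<lambda>h\<in>T. 0)"
          using that by (intro extensionalityI[of _ T]) (auto simp: roots_def dual_space_def)
        then show False
          using that by (simp add: roots_def)
      qed
    qed
    have "\<exists>t\<in>T. \<alpha> t \<noteq> \<beta> t"
    proof (rule ccontr)
      assume "\<not> ?thesis"
      then have "\<alpha> = \<beta>"
        using roots by (intro extensionalityI[of _ T]) (auto simp: roots_def dual_space_def)
      then show False
        using roots(3) by simp
    qed
    then show False
      using no_two_roots weight_vector[OF roots(1)] weight_vector[OF roots(2)] by blast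
  qed
  then show ?thesis
    using torT by (auto simp: generically_toral_def)
qed

end

theorem proposition3p1:
  fixes scale :: "'k::alg_closed_field \<Rightarrow> 'g::ab_group_add \<Rightarrow> 'g"
    and bracket :: "'g \<Rightarrow> 'g \<Rightarrow> 'g"
    and pmap :: "'g \<Rightarrow> 'g"
    and Basis :: "'g set"
  assumes "fd_restricted_lie_algebra scale bracket pmap Basis"
    and "CHAR('k) \<ge> 3"
    and "restricted_lie_algebra.p_rank scale bracket pmap = 1"
    and "restricted_lie_algebra.num_roots scale bracket pmap \<ge> 2"
  shows "restricted_lie_algebra.generically_toral scale bracket pmap"
proof -
  interpret alg_closed_restricted_lie_algebra scale bracket pmap Basis
    using assms(1,2)
    by (intro alg_closed_restricted_lie_algebra.intro alg_closed_restricted_lie_algebra_axioms.intro)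
  show ?thesis
    using assms(3,4) by (rule generically_toral_if_p_rank_1)
qed

end
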